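(* Let $\Omega_n\subset\overline{\mathbb C}$ ($n\in\mathbb N$) be regular domains that converge in the sense of kernel to a regular domain $\Omega\subset\overline{\mathbb C}$. Suppose there exists a constant $N$ such that each domain $\Omega_n$ has at most $N$ boundary components. Then for every $w\in\Omega$ the Green's functions $g_{\Omega_n}(\cdot,w)$ converge to $g_\Omega(\cdot,w)$ uniformly on $\mathbb C\setminus\{w\}$.
   Context: $\overline{\mathbb C}=\mathbb C\cup\{\infty\}$ is the Riemann sphere; a domain is a nonempty connected open set; boundaries are taken in $\overline{\mathbb C}$, and the boundary components of a domain are the connected components of its boundary. Regular domain and Green's function: a domain $\Omega\subset\overline{\mathbb C}$ is regular (for the Dirichlet problem) if for every $w\in\Omega$ there exists a function $g_\Omega(\cdot,w)$, called Green's function of $\Omega$ with pole at $w$, such that: (i) $g_\Omega(\cdot,w)$ is (real-valued and) continuous on $\overline{\mathbb C}\setminus\{w\}$ and is zero on $\overline{\mathbb C}\setminus\Omega$; (ii) $g_\Omega(\cdot,w)$ is harmonic in $\Omega\setminus\{w\}$; (iii) $g_\Omega(z,w)=-\log|z-w|+O(1)$ as $z\to w$ if $w$ is finite; (iv) $g_\Omega(z,w)=\log|z|+O(1)$ as $z\to w$ if $w=\infty$. Kernel convergence: let $w_0\in\mathbb C$ and let $\Omega_n\subset\overline{\mathbb C}$ be domains such that $w_0$ is an interior point of $\bigcap_{n=1}^\infty\Omega_n$. One says $\Omega_n\to\Omega$ in the sense of kernel convergence (with respect to $w_0$) if: (a) $\Omega$ is a domain with $w_0\in\Omega$, and for every $z\in\Omega$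 some neighborhood of $z$ lies in $\Omega_n$ for all large $n$; (b) for every $z\in\partial\Omega$ there exist $z_n\in\partial\Omega_n$ such that $z_n\to z$ as $n\to\infty$. "Converge in the sense of kernel" means with respect to some such point $w_0$. For $w\in\Omega$, condition (a) gives $w\in\Omega_n$ for all large $n$, and $g_{\Omega_n}(\cdot,w)$ is considered for those $n$. Uniform convergence on $\mathbb C\setminus\{w\}$ means $\sup_{z\in\mathbb C\setminus\{w\}}|g_{\Omega_n}(z,w)-g_\Omega(z,w)|\to0$ as $n\to\infty$. *)

theory Defs
  imports "HOL-Analysis.Analysis" "HOL-Library.Landau_Symbols"
begin

text \<open>The Riemann sphere is the one-point compactification of the plane: \<open>Some z\<close> is the finite
  point \<open>z\<close>, and \<open>None\<close> is the point at infinity.\<close>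

abbreviation riemann_sphere :: "complex option topology" where
  "riemann_sphere \<equiv> Alexandroff_compactification euclidean"

definition sphere_domain :: "complex option set \<Rightarrow> bool" where
  "sphere_domain \<Omega> \<longleftrightarrow>
     openin riemann_sphere \<Omega> \<and> connectedin riemann_sphere \<Omega> \<and> \<Omega> \<noteq> {}"

definition boundary_components :: "complex option set \<Rightarrow> complex option set set" where
  "boundary_components \<Omega> =
     connected_components_of (subtopology riemann_sphere (riemann_sphere frontier_of \<Omega>))"

text \<open>\<open>u\<close> is twice continuously differentiable on the open set \<open>S\<close> and \<open>u\<^sub>x\<^sub>x + u\<^sub>y\<^sub>y = 0\<close> there. The
  functions \<open>p, q\<close> are the first partial derivatives of \<open>u\<close>, and \<open>pxx, pxy, qyx, qyy\<close> the
  second ones.\<close>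

definition harmonic_on_plane :: "complex set \<Rightarrow> (complex \<Rightarrow> real) \<Rightarrow> bool" where
  "harmonic_on_plane S u \<longleftrightarrow> open S \<and>
     (\<exists>p q pxx pxy qyx qyy :: complex \<Rightarrow> real.
        (\<forall>z\<in>S. (u has_derivative (\<lambda>v. p z * Re v + q z * Im v)) (at z)) \<and>
        (\<forall>z\<in>S. (p has_derivative (\<lambda>v. pxx z * Re v + pxy z * Im v)) (at z)) \<and>
        (\<forall>z\<in>S. (q has_derivative (\<lambda>v. qyx z * Re v + qyy z * Im v)) (at z)) \<and>
        continuous_on S pxx \<and> continuous_on S pxy \<and>
        continuous_on S qyx \<and> continuous_on S qyy \<and>
        (\<forall>z\<in>S. pxx z + qyy z = 0))"

text \<open>The chart of the sphere at infinity, \<open>\<zeta> \<mapsto> 1 / \<zeta>\<close>.\<close>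

definition chart_infinity :: "complex \<Rightarrow> complex option" where
  "chart_infinity \<zeta> = (if \<zeta> = 0 then None else Some (1 / \<zeta>))"

text \<open>Harmonicity on a subset of the sphere is harmonicity in the two standard charts. On their
  overlap the two conditions agree, so the second one only adds harmonicity of \<open>u (1 / \<zeta>)\<close> near
  \<open>\<zeta> = 0\<close> in case the set contains infinity.\<close>

definition harmonic_on_sphere :: "complex option set \<Rightarrow> (complex option \<Rightarrow> real) \<Rightarrow> bool" where
  "harmonic_on_sphere U u \<longleftrightarrow>
     harmonic_on_plane (Some -` U) (u \<circ> Some) \<and>
     harmonic_on_plane (chart_infinity -` U) (u \<circ> chart_infinity)"

text \<open>\<open>g\<close> is Green's function of \<open>\<Omega>\<close> with pole at \<open>w\<close>. The value of \<open>g\<close> at \<open>w\<close> itself is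
  irrelevant.\<close>

definition greens_function ::
    "complex option set \<Rightarrow> complex option \<Rightarrow> (complex option \<Rightarrow> real) \<Rightarrow> bool" where
  "greens_function \<Omega> w g \<longleftrightarrow>
     continuous_map (subtopology riemann_sphere (- {w})) euclideanreal g \<and>
     (\<forall>z. z \<notin> \<Omega> \<longrightarrow> g z = 0) \<and>
     harmonic_on_sphere (\<Omega> - {w}) g \<and>
     (case w of
        Some a \<Rightarrow> (\<lambda>z. g (Some z) - (- ln (cmod (z - a)))) \<in> O[at a](\<lambda>_. 1)
      | None \<Rightarrow> (\<lambda>z. g (Some z) - ln (cmod z)) \<in> O[at_infinity](\<lambda>_. 1))"

definition regular_domain :: "complex option set \<Rightarrow> bool" where
  "regular_domain \<Omega> \<longleftrightarrow> sphere_domain \<Omega> \<and> (\<forall>w\<in>\<Omega>. \<exists>g. greens_function \<Omega> w g)"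

definition kernel_converges ::
    "complex \<Rightarrow> (nat \<Rightarrow> complex option set) \<Rightarrow> complex option set \<Rightarrow> bool" where
  "kernel_converges w0 \<Omega>s \<Omega> \<longleftrightarrow>
     (\<forall>n. sphere_domain (\<Omega>s n)) \<and>
     Some w0 \<in> riemann_sphere interior_of (\<Inter>n. \<Omega>s n) \<and>
     sphere_domain \<Omega> \<and> Some w0 \<in> \<Omega> \<and>
     (\<forall>z\<in>\<Omega>. \<exists>U. openin riemann_sphere U \<and> z \<in> U \<and> (\<forall>\<^sub>F n in sequentially. U \<subseteq> \<Omega>s n)) \<and>
     (\<forall>z \<in> riemann_sphere frontier_of \<Omega>.
        \<exists>\<zeta>. (\<forall>n. \<zeta> n \<in> riemann_sphere frontier_of (\<Omega>s n)) \<and>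
            limitin riemann_sphere \<zeta> z sequentially)"

end

theory Submission
  imports Defs "HOL-Complex_Analysis.Complex_Analysis"
begin

text \<open>A chart of the sphere moves the pole \<open>w\<close> to infinity, so that the complements \<open>E\<^sub>n\<close>, \<open>E\<close> of the
  domains become compact sets in the plane. By the maximum principle, \<open>g\<^sub>n \<le> g + \<epsilon>\<close> follows from
  \<open>g\<^sub>n \<le> \<epsilon>\<close> on \<open>\<partial>E\<close>, and \<open>g \<le> g\<^sub>n + \<epsilon>\<close> follows from \<open>g \<le> \<epsilon>\<close> on \<open>E\<^sub>n\<close>. The second condition holds for
  large \<open>n\<close> because \<open>{g \<ge> \<epsilon>}\<close> is a compact part of the limit domain.

  For the first one, Schottky's theorem gives a barrier: \<open>g\<^sub>n\<close> is small near every connected part of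
  \<open>E\<^sub>n\<close> whose diameter is bounded below, uniformly in \<open>n\<close>. If \<open>g\<^sub>n > \<epsilon>\<close> at points of \<open>\<partial>E\<close> accumulating at
  \<open>z\<close>, then all boundary components of \<open>E\<^sub>n\<close> close to \<open>z\<close> must shrink to \<open>z\<close>. But \<open>z\<close>, being regular, is
  not isolated in \<open>\<partial>E\<close>, and the nearby points of \<open>\<partial>E\<close> are limits of points of \<open>\<partial>E\<^sub>n\<close>; hence the number
  of these components exceeds \<open>N\<close>.\<close>

section \<open>Harmonic functions and the maximum principle\<close>

text \<open>The two inequalities are not equally hard, because kernel convergence controls
  \<open>\<partial>E\<^sub>n\<close> only pointwise: near each point of \<open>\<partial>E\<close>
  there are points of \<open>\<partial>E\<^sub>n\<close>. With unboundedly many components,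
  \<open>E\<^sub>n\<close> could consist of discs that become dense near \<open>\<partial>E\<close>
  but are so tiny that \<open>g\<^sub>n\<close> is large at other points of
  \<open>\<partial>E\<close>. So the size of the components has to enter. A connected piece through
  \<open>a\<close> and \<open>b\<close> bounds \<open>g\<^sub>n\<close> at \<open>\<zeta>\<close> in
  terms of the ratio of \<open>\<bar>\<zeta> - a\<bar>\<close> to
  \<open>\<bar>\<zeta> - b\<bar>\<close> alone, and this scale invariance makes the estimate uniform
  in \<open>n\<close>. A regular boundary point cannot be isolated because isolated points are
  removable for bounded harmonic functions: Green's function would stay above a positive constant
  near such a point. Growth at the pole is known only up to a bounded error. Where two logarithmic
  terms are compared there, one of them is first multiplied by \<open>1 + \<delta>\<close>, and
  \<open>\<delta>\<close> tends to 0 at the end.\<close>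

lemma open_iff_eventually_nhds: "open S \<longleftrightarrow> (\<forall>x\<in>S. \<forall>\<^sub>F y in nhds x. y \<in> S)"
  unfolding eventually_nhds open_subopen[of S] subset_eq by simp

text \<open>Locally a harmonic function is the real part of an analytic one. This form gives direct
  access to composition with analytic maps and to the maximum modulus principle. As a condition on
  germs it also suits functions patched together from different formulas.\<close>

definition harm_at :: "(complex \<Rightarrow> real) \<Rightarrow> complex \<Rightarrow> bool" where
  "harm_at u z \<longleftrightarrow> (\<exists>f. f analytic_on {z} \<and> (\<forall>\<^sub>F x in nhds z. u x = Re (f x)))"

lemma harm_at_cong:
  assumes "harm_at u z" "\<forall>\<^sub>F x in nhds z. u x = v x"
  shows "harm_at v z"
proof -
  obtain f where f: "f analytic_on {z}" "\<forall>\<^sub>F x in nhds z. u x = Re (f x)"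
    using assms(1) by (auto simp: harm_at_def)
  have "\<forall>\<^sub>F x in nhds z. v x = Re (f x)"
    using f(2) assms(2) by eventually_elim simp
  with f(1) show ?thesis by (auto simp: harm_at_def)
qed

lemma harm_at_const: "harm_at (\<lambda>_. c) z"
  unfolding harm_at_def by (rule exI[of _ "\<lambda>_. of_real c"]) auto

lemma harm_at_add:
  assumes "harm_at u z" "harm_at v z"
  shows "harm_at (\<lambda>x. u x + v x) z"
proof -
  obtain f g where "f analytic_on {z}" "\<forall>\<^sub>F x in nhds z. u x = Re (f x)"
     "g analytic_on {z}" "\<forall>\<^sub>F x in nhds z. v x = Re (g x)"
    using assms by (auto simp: harm_at_def)
  then have "(\<lambda>x. f x + g x) analytic_on {z} \<and> (\<forall>\<^sub>F x in nhds z. u x + v x = Re (f x + g x))"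
    by (auto intro: analytic_on_add elim: eventually_elim2)
  then show ?thesis unfolding harm_at_def by blast
qed

lemma harm_at_cmult:
  assumes "harm_at u z"
  shows "harm_at (\<lambda>x. c * u x) z"
proof -
  obtain f where "f analytic_on {z}" "\<forall>\<^sub>F x in nhds z. u x = Re (f x)"
    using assms by (auto simp: harm_at_def)
  then have "(\<lambda>x. of_real c * f x) analytic_on {z} \<and> (\<forall>\<^sub>F x in nhds z. c * u x = Re (of_real c * f x))"
    by (auto intro: analytic_intros elim: eventually_mono)
  then show ?thesis unfolding harm_at_def by blast
qed

lemma harm_at_compose:
  assumes "harm_at u (h z)" "h analytic_on {z}"
  shows "harm_at (\<lambda>x. u (h x)) z"
proof -
  obtain f where f: "f analytic_on {h z}" "\<forall>\<^sub>F y in nhds (h z). u y = Re (f y)"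
    using assms(1) by (auto simp: harm_at_def)
  have "isCont h z"
    using assms(2) by (simp add: analytic_at_imp_isCont)
  then have "filterlim h (nhds (h z)) (nhds z)"
    by (simp add: continuous_at tendsto_at_iff_tendsto_nhds)
  then have "\<forall>\<^sub>F x in nhds z. u (h x) = Re ((f \<circ> h) x)"
    using f(2) by (auto simp: o_def intro: eventually_compose_filterlim)
  moreover have "f \<circ> h analytic_on {z}"
    using assms(2) f(1) by (intro analytic_on_compose) auto
  ultimately show ?thesis unfolding harm_at_def by blast
qed

lemma harm_at_ln_norm:
  assumes "f analytic_on {z}" "f z \<noteq> 0"
  shows "harm_at (\<lambda>x. ln (norm (f x))) z"
proof -
  \<comment> \<open>Division by \<open>f z\<close> moves the value at \<open>z\<close> to
    \<open>1\<close>, away from the branch cut of \<open>Ln\<close>.\<close>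
  define h where "h x = Ln (f x / f z)" for x
  have "h analytic_on {z}"
    unfolding h_def using assms by (intro analytic_intros) auto
  moreover have "\<forall>\<^sub>F x in nhds z. ln (norm (f x)) - ln (norm (f z)) = Re (h x)"
  proof -
    have "isCont f z"
      using assms(1) by (simp add: analytic_at_imp_isCont)
    then have "\<forall>\<^sub>F x in nhds z. f x \<noteq> 0"
      using assms(2) by (simp add: continuous_at tendsto_at_iff_tendsto_nhds tendsto_imp_eventually_ne)
    then show ?thesis
      by eventually_elim (use assms(2) in \<open>simp add: h_def Re_Ln norm_divide ln_div\<close>)
  qed
  ultimately have "harm_at (\<lambda>x. ln (norm (f x)) - ln (norm (f z))) z"
    unfolding harm_at_def by blast
  from harm_at_add[OF this harm_at_const[of "ln (norm (f z))"]] show ?thesis by simp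
qed

lemma harm_at_isCont:
  assumes "harm_at u z"
  shows "isCont u z"
proof -
  obtain f where f: "f analytic_on {z}" "\<forall>\<^sub>F y in nhds z. u y = Re (f y)"
    using assms(1) by (auto simp: harm_at_def)
  have "isCont (\<lambda>x. Re (f x)) z"
    using analytic_at_imp_isCont[OF f(1)] by (auto simp: isCont_def intro: tendsto_Re)
  then show ?thesis
    using isCont_cong[OF f(2)] by simp
qed

lemma harm_at_local_max:
  assumes "harm_at u z" "\<forall>\<^sub>F x in nhds z. u x \<le> u z"
  shows "\<forall>\<^sub>F x in nhds z. u x = u z"
proof -
  obtain f where f: "f analytic_on {z}" "\<forall>\<^sub>F y in nhds z. u y = Re (f y)"
    using assms(1) by (auto simp: harm_at_def)
  obtain r1 where r1: "r1 > 0" "f holomorphic_on ball z r1"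
    using f(1) by (auto simp: analytic_on_def)
  have "\<forall>\<^sub>F x in nhds z. u x = Re (f x) \<and> u x \<le> u z"
    using f(2) assms(2) by eventually_elim simp
  then obtain r2 where r2: "r2 > 0" "\<And>x. x \<in> ball z r2 \<Longrightarrow> u x = Re (f x) \<and> u x \<le> u z"
    by (auto simp: eventually_nhds_metric dist_commute)
  define r where "r = min r1 r2"
  have r: "r > 0" "ball z r \<subseteq> ball z r1" "ball z r \<subseteq> ball z r2"
    using r1 r2 by (auto simp: r_def)
  \<comment> \<open>The modulus of \<open>exp f\<close> is \<open>exp (Re f)\<close>, so a local
    maximum of \<open>u\<close> is one of this modulus.\<close>
  have "(\<lambda>x. exp (f x)) constant_on ball z r"
  proof (rule maximum_modulus_principle)
    show "(\<lambda>x. exp (f x)) holomorphic_on ball z r"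
      using r1(2) r(2) by (intro holomorphic_intros) (rule holomorphic_on_subset)
    show "cmod (exp (f x)) \<le> cmod (exp (f z))" if "x \<in> ball z r" for x
    proof -
      have "z \<in> ball z r" using r(1) by simp
      then have "u x = Re (f x)" "u z = Re (f z)" "u x \<le> u z" using r2(2) that r(3) by blast+
      then show ?thesis by simp
    qed
  qed (use r(1) in simp_all)
  then obtain c where c: "\<And>x. x \<in> ball z r \<Longrightarrow> exp (f x) = c"
    by (auto simp: constant_on_def)
  have "u x = ln (norm c)" if "x \<in> ball z r" for x
  proof -
    have "u x = Re (f x)" using r2(2)[of x] that r(3) by blast
    then show ?thesis using c[OF that] by (metis ln_exp norm_exp_eq_Re)
  qed
  then have "u x = u z" if "x \<in> ball z r" for x
    using that r(1) by (metis centre_in_ball)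
  moreover have "\<forall>\<^sub>F x in nhds z. x \<in> ball z r"
    using r(1) by (intro eventually_nhds_in_open) auto
  ultimately show ?thesis
    using eventually_mono[of "\<lambda>x. x \<in> ball z r" "nhds z" "\<lambda>x. u x = u z"] by blast
qed

text \<open>A positive value \<open>e\<close> confines \<open>{u \<ge> e}\<close> to a compact part
  of \<open>G\<close>, since \<open>u < e\<close> near the frontier and near infinity. The points
  where the maximum is attained then form a set that is clopen in the whole plane, nonempty and
  bounded, which is absurd. The boundary condition is one on the upper limit, so \<open>u\<close>
  may tend to \<open>-\<infinity>\<close> there.\<close>

lemma harm_maximum_principle:
  fixes u :: "complex \<Rightarrow> real"
  assumes "open G" and harm: "\<And>z. z \<in> G \<Longrightarrow> harm_at u z"
    and bd: "\<And>z e. z \<in> frontier G \<Longrightarrow> e > 0 \<Longrightarrow> \<forall>\<^sub>F x in nhds z. x \<in> G \<longrightarrow> u x < e"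
    and inf: "\<And>e. e > 0 \<Longrightarrow> \<forall>\<^sub>F x in at_infinity. x \<in> G \<longrightarrow> u x < e"
    and "z \<in> G"
  shows "u z \<le> 0"
proof (rule ccontr)
  assume "\<not> u z \<le> 0"
  define e where "e = u z"
  have "e > 0" using \<open>\<not> u z \<le> 0\<close> by (simp add: e_def)
  define K where "K = {x \<in> G. e \<le> u x}"
  have "bounded K"
  proof -
    obtain B where "\<forall>x. B \<le> norm x \<longrightarrow> x \<in> G \<longrightarrow> u x < e"
      using inf[OF \<open>e > 0\<close>] by (auto simp: eventually_at_infinity)
    then have "norm x \<le> B" if "x \<in> K" for x
      using that by (force simp: K_def)
    then show ?thesis by (auto simp: bounded_iff)
  qed
  moreover have "closed K"
  proof -
    have "\<forall>\<^sub>F y in nhds x. y \<notin> K" if "x \<notin> K" for x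
    proof -
      consider "x \<in> G" | "x \<in> frontier G" | "x \<in> - closure G"
        using \<open>open G\<close> by (auto simp: frontier_def interior_open)
      then show ?thesis
      proof cases
        case 1
        then have "u x < e" using that by (auto simp: K_def)
        have "(u \<longlongrightarrow> u x) (nhds x)"
          using harm_at_isCont[OF harm[OF 1]] by (simp add: continuous_at tendsto_at_iff_tendsto_nhds)
        from order_tendstoD(2)[OF this \<open>u x < e\<close>] show ?thesis
          by eventually_elim (auto simp: K_def)
      next
        case 2
        from bd[OF 2 \<open>e > 0\<close>] show ?thesis
          by eventually_elim (auto simp: K_def)
      next
        case 3
        then have "\<forall>\<^sub>F y in nhds x. y \<in> - closure G"
          by (intro eventually_nhds_in_open) auto
        then show ?thesis
          by eventually_elim (use closure_subset in \<open>auto simp: K_def\<close>)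
      qed
    qed
    then have "open (- K)"
      by (simp add: open_iff_eventually_nhds)
    then show ?thesis by (simp add: closed_def)
  qed
  ultimately have "compact K" by (simp add: compact_eq_bounded_closed)
  moreover have "continuous_on K u"
    using harm_at_isCont[OF harm] by (auto simp: K_def intro!: continuous_at_imp_continuous_on)
  moreover have "z \<in> K" using \<open>z \<in> G\<close> by (auto simp: K_def e_def)
  ultimately obtain m where m: "m \<in> K" "\<And>x. x \<in> K \<Longrightarrow> u x \<le> u m"
    using continuous_attains_sup[of K u] by blast
  have G_le: "u x \<le> u m" if "x \<in> G" for x
    using m that by (cases "x \<in> K") (force simp: K_def)+
  define M where "M = {x \<in> K. u x = u m}"
  have "closed M"
    using continuous_closed_preimage[OF \<open>continuous_on K u\<close> \<open>closed K\<close> closed_singleton, of "u m"]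
    by (simp add: M_def vimage_def Int_def)
  moreover have "open M"
  proof (subst open_iff_eventually_nhds, intro ballI)
    fix x assume x: "x \<in> M"
    then have "x \<in> G" "u x = u m" by (auto simp: M_def K_def)
    have *: "\<forall>\<^sub>F y in nhds x. y \<in> G"
      using \<open>open G\<close> \<open>x \<in> G\<close> by (rule eventually_nhds_in_open)
    then have "\<forall>\<^sub>F y in nhds x. u y \<le> u x"
      by eventually_elim (use G_le \<open>u x = u m\<close> in auto)
    then have "\<forall>\<^sub>F y in nhds x. u y = u x"
      by (rule harm_at_local_max[OF harm[OF \<open>x \<in> G\<close>]])
    with * show "\<forall>\<^sub>F y in nhds x. y \<in> M"
      by eventually_elim (use \<open>u x = u m\<close> m(1) in \<open>auto simp: M_def K_def\<close>)
  qed
  moreover have "M \<noteq> {}" using m(1) by (auto simp: M_def)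
  ultimately have "M = UNIV" by (metis clopen)
  moreover have "bounded M" using \<open>bounded K\<close> by (rule bounded_subset) (auto simp: M_def)
  ultimately show False using not_bounded_UNIV by metis
qed

section \<open>Solutions of Laplace's equation as real parts of analytic functions\<close>

lemma mixed_partials_commute:
  fixes u p q pxx pxy qyx qyy :: "complex \<Rightarrow> real"
  assumes "open S" "z \<in> S"
    and u: "\<And>z. z \<in> S \<Longrightarrow> (u has_derivative (\<lambda>v. p z * Re v + q z * Im v)) (at z)"
    and p: "\<And>z. z \<in> S \<Longrightarrow> (p has_derivative (\<lambda>v. pxx z * Re v + pxy z * Im v)) (at z)"
    and q: "\<And>z. z \<in> S \<Longrightarrow> (q has_derivative (\<lambda>v. qyx z * Re v + qyy z * Im v)) (at z)"
    and cont: "continuous_on S pxy" "continuous_on S qyx"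
  shows "pxy z = qyx z"
proof -
  have "\<bar>pxy z - qyx z\<bar> \<le> e" if "e > 0" for e
  proof -
    have "\<forall>\<^sub>F x in nhds z. x \<in> S"
      using assms(1,2) by (rule eventually_nhds_in_open)
    moreover have "\<forall>\<^sub>F x in nhds z. dist (pxy x) (pxy z) < e / 2"
      using cont(1) assms(1,2) \<open>e > 0\<close>
      by (intro tendstoD) (auto simp: continuous_on_eq_continuous_at continuous_at tendsto_at_iff_tendsto_nhds)
    moreover have "\<forall>\<^sub>F x in nhds z. dist (qyx x) (qyx z) < e / 2"
      using cont(2) assms(1,2) \<open>e > 0\<close>
      by (intro tendstoD) (auto simp: continuous_on_eq_continuous_at continuous_at tendsto_at_iff_tendsto_nhds)
    ultimately have "\<forall>\<^sub>F x in nhds z. x \<in> S \<and> \<bar>pxy x - pxy z\<bar> < e/2 \<and> \<bar>qyx x - qyx z\<bar> < e/2"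
      by eventually_elim (auto simp: dist_real_def)
    then obtain d where d: "d > 0" "\<And>x. dist x z < d \<Longrightarrow> x \<in> S \<and> \<bar>pxy x - pxy z\<bar> < e/2 \<and> \<bar>qyx x - qyx z\<bar> < e/2"
      by (auto simp: eventually_nhds_metric)
    \<comment> \<open>A point of the square of side \<open>h\<close> has distance at most
      \<open>2 * h < d\<close> from \<open>z\<close>.\<close>
    define h where "h = d / 3"
    have "h > 0" using d by (simp add: h_def)
    define P where "P s t = z + Complex s t" for s t
    have near: "dist (P s t) z < d" if "0 \<le> s" "s \<le> h" "0 \<le> t" "t \<le> h" for s t
    proof -
      have "norm (Complex s t) \<le> \<bar>s\<bar> + \<bar>t\<bar>" using cmod_le[of "Complex s t"] by simp
      then show ?thesis using that \<open>h > 0\<close> by (simp add: P_def dist_norm h_def)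
    qed
    have hor: "((\<lambda>s. P s t) has_derivative (\<lambda>k. Complex k 0)) (at s)" for s t
    proof -
      have "((\<lambda>s. z + (complex_of_real s + \<i> * of_real t)) has_derivative (\<lambda>k. of_real k)) (at s)"
        by (auto intro!: derivative_eq_intros)
      then show ?thesis by (simp add: P_def Complex_eq)
    qed
    have ver: "((\<lambda>t. P s t) has_derivative (\<lambda>k. Complex 0 k)) (at t)" for s t
    proof -
      have "((\<lambda>t. z + (complex_of_real s + \<i> * of_real t)) has_derivative (\<lambda>k. \<i> * of_real k)) (at t)"
        by (auto intro!: derivative_eq_intros)
      then show ?thesis by (simp add: P_def Complex_eq)
    qed
    \<comment> \<open>The second difference over the square. Applying the mean value theorem
      horizontally and then vertically gives \<open>h\<^sup>2 * pxy\<close>, in the other order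
      \<open>h\<^sup>2 * qyx\<close>, each at some point of the square.\<close>
    define \<Delta> where "\<Delta> = u (P h h) - u (P h 0) - u (P 0 h) + u (P 0 0)"
    have DS: "P s t \<in> S" if "0 \<le> s" "s \<le> h" "0 \<le> t" "t \<le> h" for s t
      using d(2)[OF near[OF that]] by simp
    have "\<exists>s. s > 0 \<and> s < h \<and> (u (P h h) - u (P h 0)) - (u (P 0 h) - u (P 0 0)) = (h - 0) * (p (P s h) - p (P s 0))"
    proof (rule MVT2[OF \<open>h > 0\<close>, of "\<lambda>s. u (P s h) - u (P s 0)" "\<lambda>s. p (P s h) - p (P s 0)"])
      fix s assume "0 \<le> s" "s \<le> h"
      note 1 = has_derivative_compose[OF hor u, OF DS[of s h]]
      note 2 = has_derivative_compose[OF hor u, OF DS[of s 0]]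
      have "((\<lambda>s. u (P s h) - u (P s 0)) has_derivative (\<lambda>k. (p (P s h) - p (P s 0)) * k)) (at s)"
        by (rule has_derivative_eq_rhs[OF has_derivative_diff[OF 1 2]])
           (use \<open>0 \<le> s\<close> \<open>s \<le> h\<close> \<open>h > 0\<close> in \<open>auto simp: algebra_simps fun_eq_iff\<close>)
      then show "((\<lambda>s. u (P s h) - u (P s 0)) has_real_derivative (p (P s h) - p (P s 0))) (at s)"
        by (simp add: has_field_derivative_def mult_commute_abs)
    qed
    then obtain s where s: "s > 0" "s < h" "\<Delta> = h * (p (P s h) - p (P s 0))" by (auto simp: \<Delta>_def)
    have "\<exists>t. t > 0 \<and> t < h \<and> p (P s h) - p (P s 0) = (h - 0) * pxy (P s t)"
    proof (rule MVT2[OF \<open>h > 0\<close>, of "\<lambda>t. p (P s t)" "\<lambda>t. pxy (P s t)"])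
      fix t assume "0 \<le> t" "t \<le> h"
      have "((\<lambda>t. p (P s t)) has_derivative (\<lambda>k. pxy (P s t) * k)) (at t)"
        by (rule has_derivative_eq_rhs[OF has_derivative_compose[OF ver p[OF DS]]])
           (use \<open>0 \<le> t\<close> \<open>t \<le> h\<close> s in \<open>auto simp: fun_eq_iff\<close>)
      then show "((\<lambda>t. p (P s t)) has_real_derivative pxy (P s t)) (at t)"
        by (simp add: has_field_derivative_def mult_commute_abs)
    qed
    then obtain t where t: "t > 0" "t < h" "\<Delta> = h * (h * pxy (P s t))" using s by auto
    have "\<exists>s. s > 0 \<and> s < h \<and> (u (P h h) - u (P 0 h)) - (u (P h 0) - u (P 0 0)) = (h - 0) * (q (P h s) - q (P 0 s))"
    proof (rule MVT2[OF \<open>h > 0\<close>, of "\<lambda>s. u (P h s) - u (P 0 s)" "\<lambda>s. q (P h s) - q (P 0 s)"])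
      fix s assume "0 \<le> s" "s \<le> h"
      note 1 = has_derivative_compose[OF ver u, OF DS[of h s]]
      note 2 = has_derivative_compose[OF ver u, OF DS[of 0 s]]
      have "((\<lambda>s. u (P h s) - u (P 0 s)) has_derivative (\<lambda>k. (q (P h s) - q (P 0 s)) * k)) (at s)"
        by (rule has_derivative_eq_rhs[OF has_derivative_diff[OF 1 2]])
           (use \<open>0 \<le> s\<close> \<open>s \<le> h\<close> \<open>h > 0\<close> in \<open>auto simp: algebra_simps fun_eq_iff\<close>)
      then show "((\<lambda>s. u (P h s) - u (P 0 s)) has_real_derivative (q (P h s) - q (P 0 s))) (at s)"
        by (simp add: has_field_derivative_def mult_commute_abs)
    qed
    then obtain t' where t': "t' > 0" "t' < h" "\<Delta> = h * (q (P h t') - q (P 0 t'))" by (auto simp: \<Delta>_def)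
    have "\<exists>s. s > 0 \<and> s < h \<and> q (P h t') - q (P 0 t') = (h - 0) * qyx (P s t')"
    proof (rule MVT2[OF \<open>h > 0\<close>, of "\<lambda>s. q (P s t')" "\<lambda>s. qyx (P s t')"])
      fix s assume "0 \<le> s" "s \<le> h"
      have "((\<lambda>s. q (P s t')) has_derivative (\<lambda>k. qyx (P s t') * k)) (at s)"
        by (rule has_derivative_eq_rhs[OF has_derivative_compose[OF hor q[OF DS]]])
           (use \<open>0 \<le> s\<close> \<open>s \<le> h\<close> t' in \<open>auto simp: fun_eq_iff\<close>)
      then show "((\<lambda>s. q (P s t')) has_real_derivative qyx (P s t')) (at s)"
        by (simp add: has_field_derivative_def mult_commute_abs)
    qed
    then obtain s' where s': "s' > 0" "s' < h" "\<Delta> = h * (h * qyx (P s' t'))" using t' by auto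
    have "pxy (P s t) = qyx (P s' t')" using s'(3) t(3) \<open>h > 0\<close> by simp
    moreover have "\<bar>pxy (P s t) - pxy z\<bar> < e/2" using d(2)[OF near, of s t] s t by simp
    moreover have "\<bar>qyx (P s' t') - qyx z\<bar> < e/2" using d(2)[OF near, of s' t'] s' t' by simp
    ultimately show ?thesis by linarith
  qed
  then have "\<bar>pxy z - qyx z\<bar> \<le> 0" by (rule field_le_epsilon) simp
  then show ?thesis by simp
qed

lemma harmonic_on_plane_imp_harm_at:
  assumes "harmonic_on_plane S u" "z \<in> S"
  shows "harm_at u z"
proof -
  obtain p q pxx pxy qyx qyy where "open S"
    and u': "\<forall>z\<in>S. (u has_derivative (\<lambda>v. p z * Re v + q z * Im v)) (at z)"
    and p': "\<forall>z\<in>S. (p has_derivative (\<lambda>v. pxx z * Re v + pxy z * Im v)) (at z)"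
    and q': "\<forall>z\<in>S. (q has_derivative (\<lambda>v. qyx z * Re v + qyy z * Im v)) (at z)"
    and cont: "continuous_on S pxy" "continuous_on S qyx"
    and lap: "\<forall>z\<in>S. pxx z + qyy z = 0"
    using assms(1) unfolding harmonic_on_plane_def by (elim conjE exE) (rule that; assumption)
  note u = bspec[OF u'] and p = bspec[OF p'] and q = bspec[OF q']
  obtain r where r: "r > 0" "ball z r \<subseteq> S"
    using \<open>open S\<close> \<open>z \<in> S\<close> openE by blast
  \<comment> \<open>\<open>u\<^sub>x - i u\<^sub>y\<close> is the derivative of the analytic
    function sought. Its Cauchy-Riemann equations are Laplace's equation and the symmetry of the
    mixed partials; the real part of a primitive on the disc is \<open>u\<close> up to a
    constant.\<close>
  define f where "f x = complex_of_real (p x) - \<i> * of_real (q x)" for x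
  have "(f has_field_derivative (of_real (pxx x) - \<i> * of_real (pxy x))) (at x)" if "x \<in> S" for x
  proof -
    have eq: "pxy x = qyx x"
      by (rule mixed_partials_commute[OF \<open>open S\<close> that u p q cont])
    have lap': "qyy x = - pxx x" using bspec[OF lap that] by simp
    have "(f has_derivative (\<lambda>v. of_real (pxx x * Re v + pxy x * Im v) - \<i> * of_real (qyx x * Re v + qyy x * Im v))) (at x)"
      unfolding f_def
      by (intro has_derivative_diff has_derivative_of_real p[OF that] has_derivative_mult_right q[OF that])
    then show ?thesis
      unfolding has_field_derivative_def
      by (rule has_derivative_eq_rhs) (auto simp: fun_eq_iff complex_eq_iff eq lap')
  qed
  then have "f holomorphic_on ball z r"
    using r(2) by (meson field_differentiable_def field_differentiable_at_within holomorphic_on_def subsetD)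
  then obtain F where F: "\<And>x. x \<in> ball z r \<Longrightarrow> (F has_field_derivative f x) (at x)"
    using holomorphic_convex_primitive'[of "ball z r" f] at_within_open[of _ "ball z r"]
    by (metis convex_ball open_ball)
  have der: "((\<lambda>x. u x - Re (F x)) has_derivative (\<lambda>_. 0)) (at x within ball z r)" if "x \<in> ball z r" for x
  proof -
    have "(F has_derivative (\<lambda>v. f x * v)) (at x)"
      using F[OF that] by (simp add: has_field_derivative_def)
    then have "((\<lambda>x. Re (F x)) has_derivative (\<lambda>v. Re (f x * v))) (at x)"
      by (rule bounded_linear.has_derivative[OF bounded_linear_Re])
    from has_derivative_diff[OF u[of x] this] that r
    have "((\<lambda>x. u x - Re (F x)) has_derivative (\<lambda>_. 0)) (at x)"
      by (auto simp: f_def)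
    then show ?thesis by (rule has_derivative_at_withinI)
  qed
  obtain c where c: "\<And>x. x \<in> ball z r \<Longrightarrow> u x - Re (F x) = c"
    using has_derivative_zero_constant[OF convex_ball der] by auto
  have "(\<lambda>x. F x + of_real c) holomorphic_on ball z r"
    using F by (intro holomorphic_intros) (meson field_differentiable_def field_differentiable_at_within holomorphic_on_def)
  then have "(\<lambda>x. F x + of_real c) analytic_on {z}"
    using r(1) by (auto simp: analytic_on_def)
  moreover have "\<forall>\<^sub>F x in nhds z. u x = Re (F x + of_real c)"
    using r(1) c by (force simp: eventually_nhds_metric dist_commute)
  ultimately show ?thesis unfolding harm_at_def by blast
qed

section \<open>Riemann maps and Schottky's theorem\<close>

text \<open>On the sphere, \<open>C'\<close> together with infinity is the image of the connected
  set \<open>C\<close> under \<open>z \<mapsto> 1 / (z - b)\<close>, which sends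
  \<open>b \<in> C\<close> to infinity. A loop in the component of \<open>0\<close> therefore has
  all of \<open>C'\<close> on its outer side and winds around no point off the component.\<close>

lemma simply_connected_component_inverted_complement:
  fixes C :: "complex set"
  assumes "compact C" "connected C" "b \<in> C"
  defines "C' \<equiv> {t. t \<noteq> 0 \<and> b + 1 / t \<in> C}"
  shows "open (- C')" "simply_connected (connected_component_set (- C') 0)"
proof -
  obtain B where "B > 0" and B: "\<And>z. z \<in> C \<Longrightarrow> norm (z - b) \<le> B"
  proof -
    have "bounded ((\<lambda>z. z - b) ` C)"
      using \<open>compact C\<close> by (intro compact_imp_bounded compact_continuous_image continuous_intros)
    then show ?thesis using that by (auto simp: bounded_pos)
  qed
  have cont: "continuous_on (- {0}) (\<lambda>t. b + 1 / t)"
    by (intro continuous_intros) auto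
  have "- C' = ball 0 (1 / B) \<union> (- {0} \<inter> (\<lambda>t. b + 1 / t) -` (- C))"
  proof (intro set_eqI iffI)
    fix t assume "t \<in> ball 0 (1 / B) \<union> (- {0} \<inter> (\<lambda>t. b + 1 / t) -` (- C))"
    then show "t \<in> - C'"
    proof
      assume t: "t \<in> ball 0 (1 / B)"
      show ?thesis
      proof
        assume "t \<in> C'"
        then have "t \<noteq> 0" "norm (1 / t) \<le> B" using B[of "b + 1 / t"] by (auto simp: C'_def)
        then show False using t \<open>B > 0\<close> by (simp add: norm_divide field_simps)
      qed
    qed (auto simp: C'_def)
  qed (use \<open>B > 0\<close> in \<open>auto simp: C'_def\<close>)
  moreover have "open (- {0} \<inter> (\<lambda>t. b + 1 / t) -` (- C))"
    using \<open>compact C\<close> by (intro continuous_open_preimage[OF cont]) (auto simp: compact_imp_closed)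
  ultimately show op: "open (- C')" by (metis open_Un open_ball)
  then have "closed C'" by (simp add: closed_def)
  define S where "S = connected_component_set (- C') 0"
  have "0 \<in> S" by (auto simp: S_def C'_def)
  have "open S" unfolding S_def by (rule open_connected_component[OF op])
  have "S \<subseteq> - C'" unfolding S_def by (rule connected_component_subset)
  have "connected S" unfolding S_def by simp
  have "winding_number \<gamma> z = 0"
    if \<gamma>: "path \<gamma>" "path_image \<gamma> \<subseteq> S" "pathfinish \<gamma> = pathstart \<gamma>" and "z \<notin> S" for \<gamma> z
  proof -
    let ?P = "path_image \<gamma>"
    have P: "compact ?P" "closed ?P" "bounded ?P"
      using \<gamma>(1) compact_path_image compact_imp_closed compact_imp_bounded by blast+
    have oi: "open (inside ?P)" "open (outside ?P)"
      using P by (auto simp: open_inside open_outside)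
    have disj: "x \<notin> outside ?P" if "x \<in> inside ?P" for x
      using that inside_Int_outside[of ?P] by blast
    obtain R where "R > 0" and R: "- ball 0 R \<subseteq> outside ?P"
      using bounded_subset_ballD[OF P(3), of 0] outside_subset_convex[OF convex_ball] by blast
    have cont': "continuous_on (- {b}) (\<lambda>c. 1 / (c - b))"
      by (intro continuous_intros) auto
    \<comment> \<open>\<open>V1\<close> and \<open>V2\<close> pull back the inside and the outside
      of the loop; the disc around \<open>b\<close> corresponds to a neighbourhood of infinity. They
      are disjoint, open and cover \<open>C\<close>, so the connected set \<open>C\<close>, which
      meets \<open>V2\<close> in \<open>b\<close>, misses \<open>V1\<close>.\<close>
    define V1 where "V1 = - {b} \<inter> (\<lambda>c. 1 / (c - b)) -` inside ?P"
    define V2 where "V2 = ball b (1 / R) \<union> (- {b} \<inter> (\<lambda>c. 1 / (c - b)) -` outside ?P)"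
    have far: "1 / (c - b) \<in> outside ?P" if "c \<in> ball b (1 / R)" "c \<noteq> b" for c
    proof -
      have "norm (1 / (c - b)) > R"
        using that \<open>R > 0\<close> by (simp add: norm_divide dist_norm norm_minus_commute field_simps)
      then show ?thesis using R by auto
    qed
    have "open V1" "open V2"
      unfolding V1_def V2_def using oi by (auto intro!: open_Un continuous_open_preimage[OF cont'])
    moreover have "V1 \<inter> V2 = {}"
    proof -
      have False if "c \<in> V1" "c \<in> V2" for c
        using that far[of c] disj[of "1 / (c - b)"] unfolding V1_def V2_def by blast
      then show ?thesis by blast
    qed
    moreover have "C \<subseteq> V1 \<union> V2"
    proof
      fix c assume "c \<in> C"
      show "c \<in> V1 \<union> V2"
      proof (cases "c = b")
        case False
        then have "1 / (c - b) \<in> C'" using \<open>c \<in> C\<close> by (simp add: C'_def)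
        then have "1 / (c - b) \<notin> ?P" using \<gamma>(2) \<open>S \<subseteq> - C'\<close> by blast
        then have "1 / (c - b) \<in> inside ?P \<or> 1 / (c - b) \<in> outside ?P"
          using inside_Un_outside[of ?P] by blast
        then show ?thesis using False unfolding V1_def V2_def by blast
      qed (use \<open>R > 0\<close> in \<open>auto simp: V2_def\<close>)
    qed
    moreover have "b \<in> V2" using \<open>R > 0\<close> by (auto simp: V2_def)
    ultimately have "V1 \<inter> C = {}"
      using connectedD[OF \<open>connected C\<close>, of V1 V2] \<open>b \<in> C\<close> by blast
    have C'_out: "C' \<subseteq> outside ?P"
    proof
      fix t assume t: "t \<in> C'"
      then have c: "b + 1 / t \<in> C" "t \<noteq> 0" by (auto simp: C'_def)
      have "t \<notin> ?P" using t \<gamma>(2) \<open>S \<subseteq> - C'\<close> by blast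
      moreover have "t \<notin> inside ?P"
      proof
        assume "t \<in> inside ?P"
        then have "b + 1 / t \<in> V1" using c by (simp add: V1_def)
        then show False using c \<open>V1 \<inter> C = {}\<close> by blast
      qed
      ultimately show "t \<in> outside ?P" using inside_Un_outside[of ?P] by blast
    qed
    \<comment> \<open>Otherwise the component \<open>V\<close> of \<open>z\<close> in the complement
      of \<open>C'\<close> is trapped inside the loop. It is then bounded, and its nonempty frontier
      lies in \<open>C'\<close>, that is, outside the loop.\<close>
    have "z \<in> outside ?P"
    proof (rule ccontr)
      assume nz: "z \<notin> outside ?P"
      moreover have "z \<notin> ?P" using \<gamma>(2) \<open>z \<notin> S\<close> by blast
      ultimately have zi: "z \<in> inside ?P" using inside_Un_outside[of ?P] by blast
      have "z \<notin> C'" using C'_out nz by blast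
      define V where "V = connected_component_set (- C') z"
      have "z \<in> V" using \<open>z \<notin> C'\<close> by (simp add: V_def)
      have "V \<inter> S = {}"
        using \<open>z \<notin> S\<close> connected_component_disjoint[of "- C'" z 0] connected_component_sym[of "- C'" z 0]
        unfolding V_def S_def by (auto dest: connected_component_sym)
      then have "V \<subseteq> inside ?P \<union> outside ?P" using \<gamma>(2) by auto
      moreover have "connected V" unfolding V_def by simp
      ultimately have "inside ?P \<inter> V = {} \<or> outside ?P \<inter> V = {}"
        using oi by (intro connectedD) auto
      then have VI: "V \<subseteq> inside ?P"
        using zi \<open>z \<in> V\<close> \<open>V \<subseteq> inside ?P \<union> outside ?P\<close> by blast
      have "bounded V" using bounded_inside[OF P(3)] VI by (rule bounded_subset)
      then have "V \<noteq> UNIV" using not_bounded_UNIV by metis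
      then have "frontier V \<noteq> {}" using \<open>z \<in> V\<close> by (auto simp: frontier_eq_empty)
      then obtain p where p: "p \<in> frontier V" by blast
      have "frontier V \<subseteq> C'"
        using \<open>closed C'\<close> \<open>z \<notin> C'\<close> unfolding V_def
        by (intro frontier_of_components_closed_complement) (auto simp: components_def)
      then have "p \<in> outside ?P" using p C'_out by blast
      moreover have "p \<in> closure V" using p by (simp add: frontier_def)
      ultimately have "outside ?P \<inter> V \<noteq> {}"
        using oi(2) open_Int_closure_eq_empty by blast
      then show False using VI inside_Int_outside[of ?P] by blast
    qed
    then show ?thesis using \<gamma> winding_number_zero_in_outside by blast
  qed
  then have "simply_connected S"
    using simply_connected_eq_winding_number_zero[OF \<open>open S\<close>] \<open>connected S\<close> by blast
  then show "simply_connected (connected_component_set (- C') 0)" by (simp add: S_def)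
qed

lemma Riemann_mapping_normalized:
  assumes "open S" "simply_connected S" "0 \<in> S" "S \<noteq> UNIV"
  obtains F G where "F holomorphic_on S" "G holomorphic_on ball 0 1"
    "\<And>z. z \<in> S \<Longrightarrow> F z \<in> ball 0 1" "\<And>z. z \<in> S \<Longrightarrow> G (F z) = z"
    "\<And>z. z \<in> ball 0 1 \<Longrightarrow> G z \<in> S" "\<And>z. z \<in> ball 0 1 \<Longrightarrow> F (G z) = z" "F 0 = 0"
proof -
  obtain f g where fg: "f holomorphic_on S" "g holomorphic_on ball 0 1"
    "\<And>z. z \<in> S \<Longrightarrow> f z \<in> ball 0 1" "\<And>z. z \<in> S \<Longrightarrow> g (f z) = z"
    "\<And>z. z \<in> ball 0 1 \<Longrightarrow> g z \<in> S" "\<And>z. z \<in> ball 0 1 \<Longrightarrow> f (g z) = z"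
    using Riemann_mapping_theorem[of S] assms by blast
  obtain p q where pq: "p (f 0) = 0" "p holomorphic_on ball 0 1" "p ` ball 0 1 \<subseteq> ball 0 1"
     "q holomorphic_on ball 0 1" "q ` ball 0 1 \<subseteq> ball 0 1"
     "\<And>z. z \<in> ball 0 1 \<Longrightarrow> p (q z) = z" "\<And>z. z \<in> ball 0 1 \<Longrightarrow> q (p z) = z"
    using ball_biholomorphism_exists[OF fg(3)[OF \<open>0 \<in> S\<close>]] by metis
  show thesis
  proof (rule that[of "p \<circ> f" "g \<circ> q"])
    show "p \<circ> f holomorphic_on S"
      by (rule holomorphic_on_compose_gen[OF fg(1) pq(2)]) (use fg(3) in auto)
    show "g \<circ> q holomorphic_on ball 0 1"
      by (rule holomorphic_on_compose_gen[OF pq(4) fg(2) pq(5)])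
  qed (use fg pq in \<open>auto simp: image_subset_iff\<close>)
qed

text \<open>Schottky's theorem bounds functions omitting \<open>0\<close> and \<open>1\<close> from
  above. It is applied to \<open>- 1 / h\<close>, which omits \<open>1\<close> because
  \<open>h\<close> omits \<open>- 1\<close>.\<close>

lemma Schottky_lower_bound:
  fixes t :: real
  assumes "0 < t" "t < 1"
  obtains \<kappa> where "\<kappa> > 0"
    "\<And>(h :: complex \<Rightarrow> complex) (z :: complex). h holomorphic_on ball 0 1 \<Longrightarrow> h 0 = 1 \<Longrightarrow> (\<And>x. x \<in> ball 0 1 \<Longrightarrow> h x \<noteq> 0 \<and> h x \<noteq> - 1)
       \<Longrightarrow> norm z \<le> t \<Longrightarrow> \<kappa> \<le> norm (h z)"
proof -
  \<comment> \<open>\<open>Schottky\<close> needs a function on the closed disc, so \<open>h\<close>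
    is rescaled by \<open>s < 1\<close>. With \<open>s = sqrt t\<close> the condition
    \<open>\<bar>z\<bar> \<le> t\<close> becomes \<open>\<bar>z / s\<bar> \<le> s\<close>.\<close>
  define s where "s = sqrt t"
  have s: "0 < s" "s < 1" "t = s * s"
    using assms by (auto simp: s_def real_less_rsqrt)
  \<comment> \<open>Schottky's constant for \<open>\<bar>f 0\<bar> \<le> 1\<close> on the disc of
    radius \<open>s\<close>.\<close>
  define M where "M = exp (pi * exp (pi * (2 + 2 * 1 + 12 * s / (1 - s))))"
  have "M > 0" by (simp add: M_def)
  show thesis
  proof (rule that[of "1 / M"])
    fix h :: "complex \<Rightarrow> complex" and z :: complex assume h: "h holomorphic_on ball 0 1" "h 0 = 1"
      and omit: "\<And>x. x \<in> ball 0 1 \<Longrightarrow> h x \<noteq> 0 \<and> h x \<noteq> - 1" and z: "norm z \<le> t"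
    define f where "f x = - 1 / h (of_real s * x)" for x
    have in_ball: "of_real s * x \<in> ball 0 1" if "x \<in> cball 0 1" for x :: complex
    proof -
      have "s * norm x \<le> s * 1" using that s by (intro mult_left_mono) auto
      then have "s * norm x < 1" using s by linarith
      then show ?thesis using s by (simp add: norm_mult)
    qed
    have "norm (f (z / of_real s)) \<le> M"
      unfolding M_def
    proof (rule Schottky[where f = f and r = 1 and t = s])
      have "(h \<circ> (\<lambda>x. of_real s * x)) holomorphic_on cball 0 1"
        by (rule holomorphic_on_compose_gen[OF _ h(1)]) (use in_ball in \<open>auto intro!: holomorphic_intros\<close>)
      then show "f holomorphic_on cball 0 1"
        unfolding f_def using omit in_ball by (auto simp: o_def intro!: holomorphic_intros)
      show "norm (f 0) \<le> 1" using h(2) by (simp add: f_def)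
      show "\<not> (f x = 0 \<or> f x = 1)" if "x \<in> cball 0 1" for x
      proof -
        have "h (of_real s * x) \<noteq> 0" "- 1 \<noteq> h (of_real s * x)"
          using omit[OF in_ball[OF that]] by metis+
        then show ?thesis
          by (auto simp: f_def divide_eq_eq simp del: divide_minus_left minus_divide_left)
      qed
      show "norm (z / of_real s) \<le> s" using z s by (simp add: norm_divide divide_le_eq)
    qed (use s in auto)
    moreover have "of_real s * (z / of_real s) = z" using s by simp
    ultimately have "1 / norm (h z) \<le> M" by (simp add: f_def norm_divide)
    moreover have "h z \<noteq> 0" using omit[of z] z assms by auto
    ultimately show "1 / M \<le> norm (h z)" using \<open>M > 0\<close> by (simp add: field_simps)
  qed (use \<open>M > 0\<close> in auto)
qed

section \<open>Green's functions with pole at infinity\<close>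

text \<open>Green's function after its pole has been moved to infinity, with \<open>E\<close> the
  complement of the domain. At the pole only the growth is recorded.\<close>

definition green_at_infinity :: "complex set \<Rightarrow> (complex \<Rightarrow> real) \<Rightarrow> bool" where
  "green_at_infinity E g \<longleftrightarrow> continuous_on UNIV g \<and> (\<forall>z\<in>E. g z = 0) \<and> (\<forall>z. z \<notin> E \<longrightarrow> harm_at g z) \<and>
     (\<exists>M. \<forall>\<^sub>F z in at_infinity. \<bar>g z - ln (norm z)\<bar> \<le> M)"

lemma green_at_infinityD:
  assumes "green_at_infinity E g"
  shows "continuous_on UNIV g" "isCont g z" "z \<in> E \<Longrightarrow> g z = 0" "z \<notin> E \<Longrightarrow> harm_at g z"
  using assms by (auto simp: green_at_infinity_def continuous_on_eq_continuous_at)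

lemma green_at_infinity_bound:
  assumes "green_at_infinity E g"
  obtains M where "\<forall>\<^sub>F z in at_infinity. \<bar>g z - ln (norm z)\<bar> \<le> M"
  using assms by (auto simp: green_at_infinity_def)

lemma eventually_ln_norm_gt_at_infinity: "\<forall>\<^sub>F z :: complex in at_infinity. c < ln (norm z)"
proof -
  have "filterlim (\<lambda>z::complex. ln (norm z)) at_top at_infinity"
    by (rule filterlim_compose[OF ln_at_top filterlim_norm_at_top])
  then show ?thesis by (simp add: filterlim_at_top_dense)
qed

lemma eventually_less_of_isCont:
  fixes u :: "complex \<Rightarrow> real"
  assumes "isCont u z" "u z < e"
  shows "\<forall>\<^sub>F x in nhds z. u x < e"
  using assms by (intro order_tendstoD(2)) (auto simp: continuous_at tendsto_at_iff_tendsto_nhds)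

lemma green_nonneg:
  assumes "closed E" "green_at_infinity E g"
  shows "0 \<le> g z"
proof (cases "z \<in> E")
  case False
  note g = green_at_infinityD[OF assms(2)]
  obtain M where M: "\<forall>\<^sub>F z in at_infinity. \<bar>g z - ln (norm z)\<bar> \<le> M"
    using green_at_infinity_bound[OF assms(2)] .
  have "- 1 * g z \<le> 0"
  proof (rule harm_maximum_principle[of "- E" "\<lambda>x. - 1 * g x"])
    show "harm_at (\<lambda>x. - 1 * g x) x" if "x \<in> - E" for x
      using that g(4) by (intro harm_at_cmult) auto
    show "\<forall>\<^sub>F y in nhds x. y \<in> - E \<longrightarrow> - 1 * g y < e" if "x \<in> frontier (- E)" "e > 0" for x e
    proof -
      have "x \<in> E" using that(1) frontier_subset_closed[OF \<open>closed E\<close>] by (auto simp: frontier_complement)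
      then have "\<forall>\<^sub>F y in nhds x. - 1 * g y < e"
        using g(2,3) that(2) by (intro eventually_less_of_isCont continuous_intros) auto
      then show ?thesis by eventually_elim simp
    qed
    show "\<forall>\<^sub>F x in at_infinity. x \<in> - E \<longrightarrow> - 1 * g x < e" if "e > 0" for e
      using M eventually_ln_norm_gt_at_infinity[of M] by eventually_elim (use that in auto)
  qed (use False assms(1) in auto)
  then show ?thesis by simp
qed (use green_at_infinityD[OF assms(2)] in simp)

text \<open>After the inversion \<open>\<tau> z = 1 / (z - b)\<close> the component \<open>S\<close> of the origin in the complement of
  \<open>C\<close> is simply connected, with Riemann map \<open>F\<close>, \<open>F 0 = 0\<close>, and \<open>g \<le> - ln \<bar>F \<circ> \<tau>\<bar>\<close>. On the disc the
  branch of \<open>sqrt ((z - a) / (z - b))\<close> that is \<open>1\<close> at the origin omits \<open>0\<close> and also \<open>- 1\<close>, since its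
  square is \<open>1\<close> only at \<open>z = \<infinity>\<close>. Schottky's theorem therefore bounds it below on the disc of radius
  \<open>t\<close>, with a constant that does not depend on \<open>E\<close> and \<open>C\<close>.\<close>

lemma green_barrier:
  fixes t :: real
  assumes "0 < t" "t < 1"
  obtains \<kappa> where "\<kappa> > 0"
    "\<And>E g C a b \<zeta>. compact E \<Longrightarrow> green_at_infinity E g \<Longrightarrow> connected C \<Longrightarrow> C \<subseteq> E \<Longrightarrow> a \<in> C \<Longrightarrow> b \<in> C \<Longrightarrow>
       a \<noteq> b \<Longrightarrow> norm (\<zeta> - a) < \<kappa> * norm (\<zeta> - b) \<Longrightarrow> g \<zeta> \<le> - ln t"
proof -
  obtain \<kappa> where "\<kappa> > 0" and \<kappa>:
    "\<And>(h :: complex \<Rightarrow> complex) (z :: complex). h holomorphic_on ball 0 1 \<Longrightarrow> h 0 = 1 \<Longrightarrow> (\<And>x. x \<in> ball 0 1 \<Longrightarrow> h x \<noteq> 0 \<and> h x \<noteq> - 1)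
       \<Longrightarrow> norm z \<le> t \<Longrightarrow> \<kappa> \<le> norm (h z)"
    using Schottky_lower_bound[OF assms] by blast
  show thesis
  \<comment> \<open>Squared, because Schottky's bound \<open>\<kappa>\<close> is for the square root
    of \<open>(\<zeta> - a) / (\<zeta> - b)\<close>.\<close>
  proof (rule that[of "\<kappa>\<^sup>2"])
    show "\<kappa>\<^sup>2 > 0" using \<open>\<kappa> > 0\<close> by simp
  next
    fix E C :: "complex set" and g a b \<zeta>
    assume "compact E" and green: "green_at_infinity E g" and C0: "connected C" "C \<subseteq> E"
      and ab0: "a \<in> C" "b \<in> C" and "a \<noteq> b" and close: "norm (\<zeta> - a) < \<kappa>\<^sup>2 * norm (\<zeta> - b)"
    have "closed E" using \<open>compact E\<close> by (rule compact_imp_closed)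
    note g = green_at_infinityD[OF green]
    define K where "K = closure C"
    have "K \<subseteq> E" unfolding K_def using \<open>closed E\<close> C0(2) by (rule closure_minimal[rotated])
    then have "compact K"
      using \<open>compact E\<close> unfolding K_def by (metis closed_closure compact_closure compact_eq_bounded_closed bounded_subset)
    have "connected K" unfolding K_def using C0(1) by (rule connected_imp_connected_closure)
    have ab: "a \<in> K" "b \<in> K" using ab0 closure_subset by (auto simp: K_def)
    define K' where "K' = {t. t \<noteq> 0 \<and> b + 1 / t \<in> K}"
    define S where "S = connected_component_set (- K') 0"
    have op: "open (- K')" and sc: "simply_connected S"
      using simply_connected_component_inverted_complement[OF \<open>compact K\<close> \<open>connected K\<close> ab(2)]
      unfolding K'_def S_def by auto
    have "open S" unfolding S_def by (rule open_connected_component[OF op])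
    have "0 \<in> S" by (auto simp: S_def K'_def)
    have "S \<subseteq> - K'" unfolding S_def by (rule connected_component_subset)
    have "1 / (a - b) \<in> K'" using ab \<open>a \<noteq> b\<close> by (simp add: K'_def)
    then have aS: "1 / (a - b) \<notin> S" using \<open>S \<subseteq> - K'\<close> by blast
    then have "S \<noteq> UNIV" by blast
    obtain F G where FG: "F holomorphic_on S" "G holomorphic_on ball 0 1"
      "\<And>z. z \<in> S \<Longrightarrow> F z \<in> ball 0 1" "\<And>z. z \<in> S \<Longrightarrow> G (F z) = z"
      "\<And>z. z \<in> ball 0 1 \<Longrightarrow> G z \<in> S" "\<And>z. z \<in> ball 0 1 \<Longrightarrow> F (G z) = z" "F 0 = 0"
      by (rule Riemann_mapping_normalized[OF \<open>open S\<close> sc \<open>0 \<in> S\<close> \<open>S \<noteq> UNIV\<close>]) (rule that; assumption)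
    have F0: "F x \<noteq> 0" if "x \<in> S" "x \<noteq> 0" for x
      using FG(4)[OF that(1)] FG(4)[OF \<open>0 \<in> S\<close>] FG(7) that(2) by metis
    define \<tau> where "\<tau> z = 1 / (z - b)" for z
    have \<tau>_an: "\<tau> analytic_on {z}" if "z \<noteq> b" for z
      unfolding \<tau>_def using that by (intro analytic_intros) auto
    have \<tau>_lim: "(\<tau> \<longlongrightarrow> \<tau> z) (nhds z)" if "z \<noteq> b" for z
      using analytic_at_imp_isCont[OF \<tau>_an[OF that]] by (simp add: continuous_at tendsto_at_iff_tendsto_nhds)
    have nE: "z \<noteq> b" "\<tau> z \<noteq> 0" "\<tau> z \<in> - K'" if "z \<notin> E" for z
      using that \<open>K \<subseteq> E\<close> ab by (auto simp: \<tau>_def K'_def)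
    have lnF: "ln (norm (F x)) \<le> 0" if "x \<in> S" "x \<noteq> 0" for x
      using FG(3)[OF that(1)] F0[OF that] by (simp add: less_imp_le)

    have lower: "t < norm (F (\<tau> \<zeta>))" if "\<tau> \<zeta> \<in> S" "\<zeta> \<noteq> b"
    proof (rule ccontr)
      assume "\<not> t < norm (F (\<tau> \<zeta>))"
      then have small: "norm (F (\<tau> \<zeta>)) \<le> t" by simp
      \<comment> \<open>In the coordinate \<open>x = 1 / (z - b)\<close> the quotient
        \<open>(z - a) / (z - b)\<close> is \<open>1 + (b - a) * x\<close>. Its only zero,
        \<open>1 / (a - b)\<close>, lies in \<open>K'\<close> and thus not in
        \<open>S\<close>.\<close>
      define h0 where "h0 \<eta> = 1 + (b - a) * G \<eta>" for \<eta>
      have h0_nz: "h0 \<eta> \<noteq> 0" if "\<eta> \<in> ball 0 1" for \<eta>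
      proof
        assume "h0 \<eta> = 0"
        then have "G \<eta> = 1 / (a - b)" using \<open>a \<noteq> b\<close> by (simp add: h0_def field_simps)
        then show False using FG(5)[OF that] aS by simp
      qed
      have "h0 holomorphic_on ball 0 1"
        unfolding h0_def by (intro holomorphic_intros FG)
      then obtain h1 where h1: "h1 holomorphic_on ball 0 1" "\<And>\<eta>. \<eta> \<in> ball 0 1 \<Longrightarrow> h0 \<eta> = (h1 \<eta>)\<^sup>2"
        using contractible_imp_holomorphic_sqrt[of h0 "ball 0 1"] h0_nz convex_imp_contractible[OF convex_ball] by metis
      have "G 0 = 0" using FG(4)[OF \<open>0 \<in> S\<close>] FG(7) by simp
      then have "(h1 0)\<^sup>2 = 1" using h1(2)[of 0] by (simp add: h0_def)
      \<comment> \<open>\<open>h1 0\<close> is \<open>1\<close> or \<open>- 1\<close>; as a factor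
        it selects the branch with value \<open>1\<close> at the origin.\<close>
      define h where "h \<eta> = h1 0 * h1 \<eta>" for \<eta>
      have hsq: "(h \<eta>)\<^sup>2 = h0 \<eta>" if "\<eta> \<in> ball 0 1" for \<eta>
        using h1(2)[OF that] \<open>(h1 0)\<^sup>2 = 1\<close> by (simp add: h_def power_mult_distrib)
      have h_one: "h 0 = 1" using \<open>(h1 0)\<^sup>2 = 1\<close> by (simp add: h_def power2_eq_square)
      have "\<kappa> \<le> norm (h (F (\<tau> \<zeta>)))"
      proof (rule \<kappa>[of h])
        show "h 0 = 1" "norm (F (\<tau> \<zeta>)) \<le> t" by (fact h_one small)+
        show "h holomorphic_on ball 0 1" unfolding h_def by (intro holomorphic_intros h1)
        show "h x \<noteq> 0 \<and> h x \<noteq> - 1" if x: "x \<in> ball 0 1" for x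
        proof
          show "h x \<noteq> 0" using hsq[OF x] h0_nz[OF x] by auto
          show "h x \<noteq> - 1"
          proof
            assume "h x = - 1"
            then have "h0 x = 1" using hsq[OF x] by simp
            then have "G x = 0" using \<open>a \<noteq> b\<close> by (simp add: h0_def)
            then have "x = 0" using FG(6)[OF x] FG(7) by simp
            then show False using \<open>h x = - 1\<close> h_one by simp
          qed
        qed
      qed
      then have "\<kappa>\<^sup>2 \<le> (norm (h (F (\<tau> \<zeta>))))\<^sup>2" using \<open>\<kappa> > 0\<close> by (intro power_mono) auto
      also have "\<dots> = norm (h0 (F (\<tau> \<zeta>)))"
        using hsq[OF FG(3)[OF that(1)]] by (simp flip: norm_power)
      also have "h0 (F (\<tau> \<zeta>)) = (\<zeta> - a) / (\<zeta> - b)"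
        unfolding h0_def FG(4)[OF that(1)] using that(2) by (simp add: \<tau>_def field_simps)
      finally show False using close that(2) by (simp add: norm_divide field_simps)
    qed

    \<comment> \<open>The factor \<open>1 + \<delta>\<close> makes \<open>v \<delta>\<close> tend to \<open>-\<infinity>\<close> at infinity, so the maximum principle needs no
      statement about harmonicity there.\<close>
    define v where "v \<delta> z = (if \<tau> z \<in> S then g z + (1 + \<delta>) * ln (norm (F (\<tau> z))) else g z)" for \<delta> z
    have v_le: "v \<delta> \<zeta> \<le> 0" if "\<delta> > 0" "\<zeta> \<notin> E" for \<delta>
    proof (rule harm_maximum_principle[of "- E" "v \<delta>"])
      fix z assume "z \<in> - E"
      then have "z \<notin> E" by simp
      note z = nE[OF this]
      show "harm_at (v \<delta>) z"
      proof (cases "\<tau> z \<in> S")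
        case True
        have "(F \<circ> \<tau>) analytic_on {z}"
          using \<tau>_an[OF z(1)] holomorphic_on_imp_analytic_at[OF FG(1) \<open>open S\<close> True]
          by (intro analytic_on_compose) auto
        then have "harm_at (\<lambda>x. ln (norm ((F \<circ> \<tau>) x))) z"
          by (rule harm_at_ln_norm) (use F0[OF True z(2)] in simp)
        then have "harm_at (\<lambda>x. g x + (1 + \<delta>) * ln (norm (F (\<tau> x)))) z"
          using g(4)[OF \<open>z \<notin> E\<close>] by (intro harm_at_add harm_at_cmult) (auto simp: o_def)
        moreover have "\<forall>\<^sub>F x in nhds z. \<tau> x \<in> S"
          using \<tau>_lim[OF z(1)] \<open>open S\<close> True by (rule topological_tendstoD)
        then have "\<forall>\<^sub>F x in nhds z. g x + (1 + \<delta>) * ln (norm (F (\<tau> x))) = v \<delta> x"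
          by eventually_elim (simp add: v_def)
        ultimately show ?thesis by (rule harm_at_cong)
      next
        case False
        \<comment> \<open>Points near \<open>z\<close> are mapped into the component
          \<open>T\<close>, which misses \<open>S\<close>, so the formula for
          \<open>v \<delta>\<close> does not change near \<open>z\<close>.\<close>
        define T where "T = connected_component_set (- K') (\<tau> z)"
        have "open T" unfolding T_def by (rule open_connected_component[OF op])
        have "\<tau> z \<in> T" using z(3) by (simp add: T_def)
        have "T \<inter> S = {}"
          using False unfolding T_def S_def connected_component_disjoint by (auto dest: connected_component_sym)
        have "\<forall>\<^sub>F x in nhds z. \<tau> x \<in> T"
          using \<tau>_lim[OF z(1)] \<open>open T\<close> \<open>\<tau> z \<in> T\<close> by (rule topological_tendstoD)
        then have "\<forall>\<^sub>F x in nhds z. g x = v \<delta> x"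
          by eventually_elim (use \<open>T \<inter> S = {}\<close> in \<open>auto simp: v_def\<close>)
        with g(4)[OF \<open>z \<notin> E\<close>] show ?thesis by (rule harm_at_cong)
      qed
    next
      fix z e assume "z \<in> frontier (- E)" and "e > (0::real)"
      then have "z \<in> E" using frontier_subset_closed[OF \<open>closed E\<close>] by (auto simp: frontier_complement)
      then have "\<forall>\<^sub>F x in nhds z. g x < e"
        using g(2,3) \<open>e > 0\<close> by (intro eventually_less_of_isCont) auto
      then show "\<forall>\<^sub>F x in nhds z. x \<in> - E \<longrightarrow> v \<delta> x < e"
      proof eventually_elim
        case (elim x)
        show ?case
        proof
          assume "x \<in> - E"
          then have "\<tau> x \<noteq> 0" using nE by auto
          then have "v \<delta> x \<le> g x"
            using lnF[of "\<tau> x"] \<open>\<delta> > 0\<close> by (auto simp: v_def mult_nonneg_nonpos)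
          then show "v \<delta> x < e" using elim by simp
        qed
      qed
    next
      fix e :: real assume "e > 0"
      obtain M where M: "\<forall>\<^sub>F z in at_infinity. \<bar>g z - ln (norm z)\<bar> \<le> M"
        using green_at_infinity_bound[OF green] .
      \<comment> \<open>As \<open>F 0 = 0\<close>, the quotient \<open>F x / x\<close> is bounded
        near \<open>0\<close>. Hence \<open>ln \<bar>F (\<tau> z)\<bar>\<close> is at most
        \<open>- ln \<bar>z\<bar>\<close> plus a constant and cancels the growth of
        \<open>g\<close>.\<close>
      obtain D where "(F has_field_derivative D) (at 0)"
        using FG(1) \<open>open S\<close> \<open>0 \<in> S\<close> by (meson field_differentiable_def holomorphic_on_imp_differentiable_at)
      then have "((\<lambda>x. F x / x) \<longlongrightarrow> D) (at 0)"
        by (simp add: DERIV_def FG(7))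
      then have "((\<lambda>x. norm (F x / x)) \<longlongrightarrow> norm D) (at 0)" by (rule tendsto_norm)
      then have "\<forall>\<^sub>F x in at 0. norm (F x / x) < norm D + 1"
        by (rule order_tendstoD(2)) simp
      moreover have lim: "(\<tau> \<longlongrightarrow> 0) at_infinity"
      proof -
        have "filterlim (\<lambda>z. - b + z) at_infinity at_infinity"
          by (rule tendsto_add_filterlim_at_infinity[OF tendsto_const filterlim_ident])
        then show ?thesis
          unfolding \<tau>_def by (intro tendsto_divide_0[OF tendsto_const]) (simp add: algebra_simps)
      qed
      \<comment> \<open>This gives \<open>\<bar>z - b\<bar> \<ge> \<bar>z\<bar> / 2\<close>, the
        origin of the \<open>ln 2\<close> below, and keeps \<open>z\<close> away from
        \<open>b\<close> and \<open>0\<close>.\<close>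
      have big: "\<forall>\<^sub>F z in at_infinity. norm z > 2 * norm b + 1"
        using filterlim_at_top_dense[THEN iffD1, OF filterlim_norm_at_top] by blast
      have "\<forall>\<^sub>F z in at_infinity. \<tau> z \<noteq> 0"
        using big
      proof eventually_elim
        case (elim z)
        then have "z \<noteq> b" by (smt (verit) norm_ge_zero)
        then show ?case by (simp add: \<tau>_def)
      qed
      with lim have "filterlim \<tau> (at 0) at_infinity" by (simp add: filterlim_at)
      ultimately have 1: "\<forall>\<^sub>F z in at_infinity. norm (F (\<tau> z) / \<tau> z) < norm D + 1"
        by (rule eventually_compose_filterlim)
      have 2: "\<forall>\<^sub>F z in at_infinity. \<tau> z \<in> S"
        using lim \<open>open S\<close> \<open>0 \<in> S\<close> by (rule topological_tendstoD)
      \<comment> \<open>The constant in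
        \<open>v \<delta> x \<le> A - \<delta> * ln \<bar>x\<bar>\<close>.\<close>
      define A where "A = M + (1 + \<delta>) * (ln (norm D + 1) + ln 2)"
      from 1 2 M big eventually_ln_norm_gt_at_infinity[of "A / \<delta>"]
      show "\<forall>\<^sub>F x in at_infinity. x \<in> - E \<longrightarrow> v \<delta> x < e"
      proof eventually_elim
        case (elim x)
        have "x \<noteq> b" "x \<noteq> 0" using elim(4) by (smt (verit) norm_ge_zero norm_zero)+
        then have "\<tau> x \<noteq> 0" by (simp add: \<tau>_def)
        have "norm x \<le> norm (x - b) + norm b" using norm_triangle_sub[of x b] by simp
        then have "norm x / 2 \<le> norm (x - b)" using elim(4) by simp
        have "norm (F (\<tau> x)) < (norm D + 1) * norm (\<tau> x)"
          using elim(1) \<open>\<tau> x \<noteq> 0\<close> by (simp add: norm_divide field_simps)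
        also have "\<dots> \<le> (norm D + 1) * (2 / norm x)"
          using \<open>norm x / 2 \<le> norm (x - b)\<close> \<open>x \<noteq> 0\<close> \<open>x \<noteq> b\<close>
          by (intro mult_left_mono) (auto simp: \<tau>_def norm_divide field_simps)
        finally have less: "norm (F (\<tau> x)) < (norm D + 1) * (2 / norm x)" .
        have pos: "0 < norm (F (\<tau> x))" using F0[OF elim(2) \<open>\<tau> x \<noteq> 0\<close>] by simp
        have "ln (norm (F (\<tau> x))) < ln ((norm D + 1) * (2 / norm x))"
          by (rule ln_less_cancel_iff[THEN iffD2, OF pos less_trans[OF pos less] less])
        also have "\<dots> = ln (norm D + 1) + ln 2 - ln (norm x)"
        proof -
          have "norm D + 1 > 0" by (simp add: add_nonneg_pos)
          then have "ln ((norm D + 1) * (2 / norm x)) = ln (norm D + 1) + ln (2 / norm x)"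
            using \<open>x \<noteq> 0\<close> by (intro ln_mult_pos) auto
          also have "ln (2 / norm x) = ln 2 - ln (norm x)"
            using \<open>x \<noteq> 0\<close> by (intro ln_divide_pos) auto
          finally show ?thesis by simp
        qed
        finally have "(1 + \<delta>) * ln (norm (F (\<tau> x))) \<le> (1 + \<delta>) * (ln (norm D + 1) + ln 2 - ln (norm x))"
          using \<open>\<delta> > 0\<close> by (intro mult_left_mono) auto
        then have "v \<delta> x \<le> A - \<delta> * ln (norm x)"
          using elim(2,3) by (simp add: v_def A_def algebra_simps)
        moreover have "A < \<delta> * ln (norm x)" using elim(5) \<open>\<delta> > 0\<close> by (simp add: field_simps)
        ultimately show ?case using \<open>e > 0\<close> by simp
      qed
    qed (use \<open>closed E\<close> that in auto)

    have "ln t < 0" using assms by simp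
    show "g \<zeta> \<le> - ln t"
    proof (cases "\<zeta> \<in> E")
      case True
      then show ?thesis using g(3) \<open>ln t < 0\<close> by simp
    next
      case False
      show ?thesis
      proof (cases "\<tau> \<zeta> \<in> S")
        case True
        have "ln t \<le> ln (norm (F (\<tau> \<zeta>)))"
          using lower[OF True nE(1)[OF False]] assms by (intro ln_mono) auto
        then have "g \<zeta> \<le> (1 + \<delta>) * (- ln t)" if "\<delta> > 0" for \<delta>
        proof -
          have "(1 + \<delta>) * ln t \<le> (1 + \<delta>) * ln (norm (F (\<tau> \<zeta>)))"
            using \<open>ln t \<le> _\<close> that by (intro mult_left_mono) auto
          then show ?thesis using v_le[OF that False] True by (simp add: v_def)
        qed
        then have "g \<zeta> \<le> - ln t + e" if "e > 0" for e
        proof -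
          have "0 < e / (- ln t)" using that \<open>ln t < 0\<close> by (intro divide_pos_pos) auto
          from \<open>\<And>\<delta>. \<delta> > 0 \<Longrightarrow> g \<zeta> \<le> (1 + \<delta>) * (- ln t)\<close>[OF this]
          moreover have "(1 + e / (- ln t)) * (- ln t) = - ln t + e"
            using \<open>ln t < 0\<close> by (simp add: field_simps)
          ultimately show ?thesis by simp
        qed
        then show ?thesis by (rule field_le_epsilon)
      next
        case F: False
        then have "g \<zeta> \<le> 0" using v_le[of 1, OF _ False] by (simp add: v_def)
        then show ?thesis using \<open>ln t < 0\<close> by simp
      qed
    qed
  qed
qed

text \<open>Around an isolated \<open>z\<close>, \<open>g\<close> would stay above its minimum
  \<open>c > 0\<close> on a small circle, against continuity and \<open>g z = 0\<close>. The
  hypothesis \<open>conn\<close> says that no part of the complement of \<open>E\<close> is cut off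
  from infinity; this is what makes \<open>g\<close> positive off \<open>E\<close>.\<close>

lemma frontier_not_isolated:
  assumes "compact E" and green: "green_at_infinity E g"
    and conn: "\<And>A. open A \<Longrightarrow> bounded A \<Longrightarrow> A \<subseteq> - E \<Longrightarrow> open (- E - A) \<Longrightarrow> A = {}"
    and z: "z \<in> frontier E" and "r > 0"
  obtains p where "p \<in> frontier E" "p \<noteq> z" "dist p z < r"
proof (rule ccontr)
  assume no: "\<not> thesis"
  note g = green_at_infinityD[OF green]
  have "closed E" using \<open>compact E\<close> by (rule compact_imp_closed)
  then have "z \<in> E" using z frontier_subset_closed by blast
  have nonneg: "0 \<le> g x" for x using green_nonneg[OF \<open>closed E\<close> green] .
  have pos: "0 < g x" if "x \<notin> E" for x
  proof -
    \<comment> \<open>At a zero off \<open>E\<close> the function \<open>g\<close> has a minimum, so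
      \<open>A\<close> is open. It is relatively closed by continuity, and bounded because
      \<open>g\<close> grows at infinity.\<close>
    define A where "A = {y. y \<notin> E \<and> g y = 0}"
    have "A = {}"
    proof (rule conn)
      show "open A"
        unfolding open_iff_eventually_nhds
      proof
        fix y assume "y \<in> A"
        then have y: "y \<notin> E" "g y = 0" by (auto simp: A_def)
        have "harm_at (\<lambda>x. - 1 * g x) y" using g(4)[OF y(1)] by (rule harm_at_cmult)
        moreover have "\<forall>\<^sub>F x in nhds y. - 1 * g x \<le> - 1 * g y" using nonneg y(2) by simp
        ultimately have "\<forall>\<^sub>F x in nhds y. - 1 * g x = - 1 * g y" by (rule harm_at_local_max)
        moreover have "\<forall>\<^sub>F x in nhds y. x \<in> - E"
          using \<open>closed E\<close> y(1) by (intro eventually_nhds_in_open) auto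
        ultimately show "\<forall>\<^sub>F x in nhds y. x \<in> A"
          by eventually_elim (use y(2) in \<open>auto simp: A_def\<close>)
      qed
      have "- E - A = - E \<inter> g -` (- {0})" by (auto simp: A_def)
      moreover have "open (- E \<inter> g -` (- {0}))"
        using \<open>closed E\<close> continuous_on_subset[OF g(1)] by (intro continuous_open_preimage) auto
      ultimately show "open (- E - A)" by simp
      obtain M where M: "\<forall>\<^sub>F z in at_infinity. \<bar>g z - ln (norm z)\<bar> \<le> M"
        using green_at_infinity_bound[OF green] .
      have "\<forall>\<^sub>F x in at_infinity. x \<notin> A"
        using M eventually_ln_norm_gt_at_infinity[of M] by eventually_elim (auto simp: A_def)
      then obtain B where "\<forall>x. B \<le> norm x \<longrightarrow> x \<notin> A" by (auto simp: eventually_at_infinity)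
      then show "bounded A" unfolding bounded_iff by (meson linear)
    qed (auto simp: A_def)
    then show ?thesis using that nonneg[of x] by (auto simp: A_def order_less_le)
  qed
  \<comment> \<open>Without further frontier points the connected punctured disc lies in
    \<open>E\<close> or in its complement. The first is impossible, since \<open>z\<close> is a
    limit of points off \<open>E\<close>.\<close>
  have punct: "ball z r - {z} \<subseteq> - E"
  proof (rule ccontr)
    assume "\<not> ball z r - {z} \<subseteq> - E"
    then have 1: "(ball z r - {z}) \<inter> E \<noteq> {}" by blast
    have "z \<in> closure (- E)" using z by (simp add: frontier_closures)
    then obtain y where "y \<in> - E" "dist y z < r" using \<open>r > 0\<close> by (auto simp: closure_approachable)
    then have "y \<in> (ball z r - {z}) - E" using \<open>z \<in> E\<close> by (auto simp: dist_commute)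
    then have 2: "(ball z r - {z}) - E \<noteq> {}" by blast
    have "connected (ball z r - {z})" by (rule connected_punctured_ball) simp
    then have "(ball z r - {z}) \<inter> frontier E \<noteq> {}"
      using 1 2 by (rule connected_Int_frontier)
    then obtain p where "p \<in> (ball z r - {z}) \<inter> frontier E" by blast
    then have "p \<in> frontier E" "p \<noteq> z" "dist p z < r" by (simp_all add: dist_commute)
    then show False using no that by blast
  qed
  define \<rho> where "\<rho> = r / 2"
  have \<rho>: "\<rho> > 0" "\<rho> < r" using \<open>r > 0\<close> by (auto simp: \<rho>_def)
  have "sphere z \<rho> \<noteq> {}" using \<rho> by simp
  then obtain m where m: "m \<in> sphere z \<rho>" "\<And>x. x \<in> sphere z \<rho> \<Longrightarrow> g m \<le> g x"
    using continuous_attains_inf[OF compact_sphere _ continuous_on_subset[OF g(1)], of z \<rho>] by auto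
  define c where "c = g m"
  have "m \<notin> E" using punct m(1) \<rho> by (auto simp: subset_iff)
  then have "c > 0" using pos by (simp add: c_def)
  \<comment> \<open>The term \<open>\<delta> * (ln \<bar>x - z\<bar> - ln \<rho>)\<close> vanishes
    on the circle and tends to \<open>-\<infinity>\<close> at \<open>z\<close>, so the values of
    \<open>g\<close> near \<open>z\<close> do not matter for the maximum principle.\<close>
  have le: "c \<le> g x + \<delta> * (ln \<rho> - ln (norm (x - z)))" if "\<delta> > 0" and x: "x \<in> ball z \<rho> - {z}" for \<delta> x
  proof -
    define u where "u x = (c + - 1 * g x) + \<delta> * (ln (norm (x - z)) + - ln \<rho>)" for x
    have "u x \<le> 0"
    proof (rule harm_maximum_principle[of "ball z \<rho> - {z}" u])
      show "harm_at u y" if "y \<in> ball z \<rho> - {z}" for y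
      proof -
        have "y \<notin> E" "y \<noteq> z" using that punct \<rho> by (auto simp: subset_iff)
        then show ?thesis
          unfolding u_def
          by (intro harm_at_add harm_at_const harm_at_cmult g(4) harm_at_ln_norm analytic_intros) auto
      qed
    next
      fix y e assume y: "y \<in> frontier (ball z \<rho> - {z})" and "e > (0::real)"
      have "frontier (ball z \<rho> - {z}) \<subseteq> sphere z \<rho> \<union> {z}"
        using frontier_Int_subset[of "ball z \<rho>" "- {z}"] frontier_subset_closed[of "{z}"] \<rho>
        by (simp add: Diff_eq frontier_complement) blast
      then have "y = z \<or> y \<in> sphere z \<rho> \<and> y \<noteq> z" using y by blast
      then consider "y = z" | "y \<in> sphere z \<rho>" "y \<noteq> z" by blast
      then show "\<forall>\<^sub>F x in nhds y. x \<in> ball z \<rho> - {z} \<longrightarrow> u x < e"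
      proof cases
        case 1
        have "filterlim (\<lambda>x. norm (x - z)) (at_right 0) (at z)"
          unfolding filterlim_at
        proof
          show "\<forall>\<^sub>F x in at z. norm (x - z) \<in> {0<..} \<and> norm (x - z) \<noteq> 0"
            using eventually_neq_at_within[of z z UNIV] by eventually_elim simp
          have "((\<lambda>x. norm (x - z)) \<longlongrightarrow> norm (z - z)) (at z)" by (intro tendsto_intros)
          then show "((\<lambda>x. norm (x - z)) \<longlongrightarrow> 0) (at z)" by simp
        qed
        then have "filterlim (\<lambda>x. ln (norm (x - z))) at_bot (at z)"
          by (rule filterlim_compose[OF ln_at_0])
        then have "\<forall>\<^sub>F x in at z. ln (norm (x - z)) < ln \<rho> - c / \<delta>"
          by (simp add: filterlim_at_bot_dense)
        then have "\<forall>\<^sub>F x in nhds z. x \<noteq> z \<longrightarrow> ln (norm (x - z)) < ln \<rho> - c / \<delta>"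
          by (simp add: eventually_at_filter)
        then show ?thesis unfolding 1
        proof eventually_elim
          case (elim x)
          show ?case
          proof
            assume "x \<in> ball z \<rho> - {z}"
            then have "\<delta> * ln (norm (x - z)) < \<delta> * (ln \<rho> - c / \<delta>)"
              using elim \<open>\<delta> > 0\<close> by simp
            also have "\<dots> = \<delta> * ln \<rho> - c" using \<open>\<delta> > 0\<close> by (simp add: field_simps)
            finally show "u x < e" using nonneg[of x] \<open>e > 0\<close> by (simp add: u_def algebra_simps)
          qed
        qed
      next
        case 2
        have "dist y z = \<rho>" using 2 by (simp add: dist_commute)
        then have "u y \<le> 0" using m(2)[of y] 2 by (simp add: u_def c_def dist_norm)
        moreover have "isCont u y"
          unfolding u_def using 2 g(2) by (intro continuous_intros) auto
        ultimately have "\<forall>\<^sub>F x in nhds y. u x < e"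
          using \<open>e > 0\<close> by (intro eventually_less_of_isCont) auto
        then show ?thesis by eventually_elim simp
      qed
    next
      fix e :: real
      have "\<forall>\<^sub>F x in at_infinity. norm z + \<rho> < norm (x :: complex)"
        using filterlim_at_top_dense[THEN iffD1, OF filterlim_norm_at_top] by blast
      then show "\<forall>\<^sub>F x in at_infinity. x \<in> ball z \<rho> - {z} \<longrightarrow> u x < e"
      proof eventually_elim
        case (elim x)
        then have "x \<notin> ball z \<rho>"
          using norm_triangle_sub[of x z] by (auto simp: dist_norm norm_minus_commute)
        then show ?case by simp
      qed
    qed (use x in auto)
    then show ?thesis by (simp add: u_def algebra_simps)
  qed
  have ge: "c \<le> g x" if x: "x \<in> ball z \<rho> - {z}" for x
  proof (rule field_le_epsilon)
    fix e :: real assume "e > 0"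
    define L where "L = ln \<rho> - ln (norm (x - z))"
    have "0 < norm (x - z)" "norm (x - z) < \<rho>" using x by (auto simp: dist_norm norm_minus_commute)
    then have "ln (norm (x - z)) < ln \<rho>" using \<rho> by simp
    then have "L > 0" by (simp add: L_def)
    then show "c \<le> g x + e"
      using le[of "e / L", OF _ x] \<open>e > 0\<close> by (simp add: L_def[symmetric])
  qed
  have "\<forall>\<^sub>F x in nhds z. g x < c"
    using g(2,3) \<open>z \<in> E\<close> \<open>c > 0\<close> by (intro eventually_less_of_isCont) auto
  then obtain d where d: "d > 0" "\<And>x. dist x z < d \<Longrightarrow> g x < c" by (auto simp: eventually_nhds_metric)
  define x where "x = z + of_real (min d \<rho> / 2)"
  have "dist x z = min d \<rho> / 2" using d \<rho> by (simp add: x_def dist_norm)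
  then have "dist x z < d" "dist x z < \<rho>" "dist x z > 0" using d \<rho> by auto
  then show False using ge[of x] d(2)[of x] by (auto simp: dist_commute)
qed

section \<open>Comparison inequalities for Green's functions\<close>

lemma green_le_on_of_frontier:
  assumes "closed E" "green_at_infinity E g" "compact K" "0 \<le> e"
    and fr: "\<And>z. z \<in> frontier K \<Longrightarrow> g z \<le> e" and "z \<in> K"
  shows "g z \<le> e"
proof (cases "z \<in> frontier K \<or> z \<in> E")
  case True
  then show ?thesis using fr \<open>0 \<le> e\<close> green_at_infinityD(3)[OF assms(2)] by auto
next
  case False
  note g = green_at_infinityD[OF assms(2)]
  have "z \<in> interior K" using False \<open>z \<in> K\<close> by (auto simp: frontier_def closure_def)
  \<comment> \<open>\<open>K\<close> and \<open>E\<close> may overlap in any way. The part of the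
    interior of \<open>K\<close> off \<open>E\<close> has its frontier in \<open>frontier K\<close>
    and \<open>E\<close>, and \<open>g \<le> e\<close> holds on both.\<close>
  have "g z + - e \<le> 0"
  proof (rule harm_maximum_principle[of "interior K \<inter> - E" "\<lambda>x. g x + - e"])
    show "harm_at (\<lambda>x. g x + - e) x" if "x \<in> interior K \<inter> - E" for x
      using that g(4) by (intro harm_at_add harm_at_const) auto
  next
    fix x d assume x: "x \<in> frontier (interior K \<inter> - E)" and "d > (0::real)"
    have "frontier (interior K \<inter> - E) \<subseteq> frontier K \<union> E"
      using frontier_Int_subset[of "interior K" "- E"] frontier_interior_subset[of K]
        frontier_subset_closed[OF \<open>closed E\<close>] by (auto simp: frontier_complement)
    then have "g x \<le> e" using x fr g(3) \<open>0 \<le> e\<close> by auto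
    then have "\<forall>\<^sub>F y in nhds x. g y + - e < d"
      using g(2) \<open>d > 0\<close> by (intro eventually_less_of_isCont continuous_intros) auto
    then show "\<forall>\<^sub>F y in nhds x. y \<in> interior K \<inter> - E \<longrightarrow> g y + - e < d"
      by eventually_elim simp
  next
    fix d :: real
    obtain B where B: "\<And>x. x \<in> K \<Longrightarrow> norm x \<le> B"
      using compact_imp_bounded[OF \<open>compact K\<close>] by (auto simp: bounded_iff)
    have "\<forall>\<^sub>F x in at_infinity. B < norm (x :: complex)"
      using filterlim_at_top_dense[THEN iffD1, OF filterlim_norm_at_top] by blast
    then show "\<forall>\<^sub>F x in at_infinity. x \<in> interior K \<inter> - E \<longrightarrow> g x + - e < d"
      by eventually_elim (use B interior_subset in force)
  qed (use \<open>closed E\<close> \<open>z \<in> interior K\<close> False in auto)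
  then show ?thesis by simp
qed

text \<open>The maximum principle runs on the complement of the union of \<open>E1\<close> and
  \<open>E2\<close>: \<open>g1\<close> vanishes on \<open>E1\<close>, is at most \<open>e\<close> on
  \<open>E2\<close>, and \<open>g2 \<ge> 0\<close> everywhere.\<close>

lemma green_comparison:
  assumes E1: "closed E1" "green_at_infinity E1 g1" and E2: "closed E2" "green_at_infinity E2 g2"
    and le: "\<And>z. z \<in> E2 \<Longrightarrow> g1 z \<le> e" and "0 \<le> e"
  shows "g1 z \<le> g2 z + e"
proof -
  note g1 = green_at_infinityD[OF E1(2)] and g2 = green_at_infinityD[OF E2(2)]
  have nonneg: "0 \<le> g2 x" for x using green_nonneg[OF E2] .
  consider "z \<in> E1" | "z \<in> E2" | "z \<notin> E1" "z \<notin> E2" by blast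
  then show ?thesis
  proof cases
    case 1
    then show ?thesis using g1(3) nonneg[of z] \<open>0 \<le> e\<close> by simp
  next
    case 2
    then show ?thesis using le nonneg[of z] by fastforce
  next
    case 3
    \<comment> \<open>Near infinity \<open>g1 - g2\<close> is only known to be bounded; the
      additional \<open>\<delta> * g2\<close> drives \<open>u\<close> to
      \<open>-\<infinity>\<close>.\<close>
    have *: "g1 z + - e \<le> (1 + \<delta>) * g2 z" if "\<delta> > 0" for \<delta>
    proof -
      define u where "u x = (g1 x + - e) + - (1 + \<delta>) * g2 x" for x
      have "u z \<le> 0"
      proof (rule harm_maximum_principle[of "- (E1 \<union> E2)" u])
        show "harm_at u x" if "x \<in> - (E1 \<union> E2)" for x
          unfolding u_def using that by (intro harm_at_add harm_at_const harm_at_cmult g1 g2) auto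
      next
        fix x d assume "x \<in> frontier (- (E1 \<union> E2))" and "d > (0::real)"
        then have "x \<in> E1 \<union> E2"
          using frontier_subset_closed[OF closed_Un[OF E1(1) E2(1)]]
          by (simp only: frontier_complement) blast
        then have "g1 x \<le> e" using g1(3) le \<open>0 \<le> e\<close> by auto
        moreover have "0 \<le> (1 + \<delta>) * g2 x" using nonneg[of x] that by simp
        ultimately have "u x \<le> 0" by (simp add: u_def algebra_simps)
        then have "\<forall>\<^sub>F y in nhds x. u y < d"
          unfolding u_def using g1(2) g2(2) \<open>d > 0\<close>
          by (intro eventually_less_of_isCont continuous_intros) (auto simp: u_def)
        then show "\<forall>\<^sub>F y in nhds x. y \<in> - (E1 \<union> E2) \<longrightarrow> u y < d"
          by eventually_elim simp
      next
        fix d :: real assume "d > 0"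
        obtain M1 where M1: "\<forall>\<^sub>F z in at_infinity. \<bar>g1 z - ln (norm z)\<bar> \<le> M1"
          using green_at_infinity_bound[OF E1(2)] .
        obtain M2 where M2: "\<forall>\<^sub>F z in at_infinity. \<bar>g2 z - ln (norm z)\<bar> \<le> M2"
          using green_at_infinity_bound[OF E2(2)] .
        define A where "A = M1 + (1 + \<delta>) * M2"
        from M1 M2 eventually_ln_norm_gt_at_infinity[of "A / \<delta>"]
        show "\<forall>\<^sub>F x in at_infinity. x \<in> - (E1 \<union> E2) \<longrightarrow> u x < d"
        proof eventually_elim
          case (elim x)
          have "ln (norm x) - M2 \<le> g2 x" using elim(2) by linarith
          then have "(1 + \<delta>) * (ln (norm x) - M2) \<le> (1 + \<delta>) * g2 x"
            using that by (intro mult_left_mono) auto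
          moreover have "A < \<delta> * ln (norm x)" using elim(3) that by (simp add: field_simps)
          moreover have "g1 x \<le> ln (norm x) + M1" using elim(1) by linarith
          ultimately have "u x < 0" using \<open>0 \<le> e\<close> by (simp add: u_def A_def algebra_simps)
          then show ?case using \<open>d > 0\<close> by simp
        qed
      qed (use 3 E1(1) E2(1) in \<open>auto intro!: closed_Un\<close>)
      then show ?thesis by (simp add: u_def algebra_simps)
    qed
    show ?thesis
    proof (cases "g2 z = 0")
      case True
      then show ?thesis using *[of 1] by simp
    next
      case False
      then have "g2 z > 0" using nonneg[of z] by simp
      have "g1 z + - e \<le> g2 z + d" if "d > 0" for d
      proof -
        have "(1 + d / g2 z) * g2 z = g2 z + d" using \<open>g2 z > 0\<close> by (simp add: field_simps)
        then show ?thesis using *[of "d / g2 z"] \<open>g2 z > 0\<close> that by simp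
      qed
      then have "g1 z + - e \<le> g2 z" by (rule field_le_epsilon)
      then show ?thesis by simp
    qed
  qed
qed

section \<open>Convergence in the plane\<close>

lemma green_small_on_frontier:
  fixes Es :: "nat \<Rightarrow> complex set" and gs :: "nat \<Rightarrow> complex \<Rightarrow> real" and N :: nat
  assumes "compact E" and green: "green_at_infinity E g"
    and conn: "\<And>A. open A \<Longrightarrow> bounded A \<Longrightarrow> A \<subseteq> - E \<Longrightarrow> open (- E - A) \<Longrightarrow> A = {}"
    and ev: "\<forall>\<^sub>F n in sequentially. compact (Es n) \<and> green_at_infinity (Es n) (gs n)"
    and bdry: "\<And>z. z \<in> frontier E \<Longrightarrow>
       \<exists>\<zeta>. (\<forall>\<^sub>F n in sequentially. \<zeta> n \<in> frontier (Es n)) \<and> \<zeta> \<longlonglongrightarrow> z"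
    and comps: "\<forall>\<^sub>F n in sequentially. finite (\<C> n) \<and> card (\<C> n) \<le> N \<and> \<Union> (\<C> n) = frontier (Es n)
       \<and> (\<forall>C\<in>\<C> n. connected C)"
    and "e > 0"
  shows "\<forall>\<^sub>F n in sequentially. \<forall>z\<in>frontier E. gs n z \<le> e"
proof (rule ccontr)
  assume neg: "\<not> ?thesis"
  \<comment> \<open>Violations occur along a subsequence, and by compactness of the frontier a
    further one makes the bad points converge. Everything below happens along
    \<open>q\<close>.\<close>
  obtain r :: "nat \<Rightarrow> nat" where r: "strict_mono r" "\<And>k. \<not> (\<forall>z\<in>frontier E. gs (r k) z \<le> e)"
    using not_eventually_sequentiallyD[OF neg] by blast
  then obtain x where x: "\<And>k. x k \<in> frontier E" "\<And>k. e < gs (r k) (x k)"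
    by (metis not_less)
  have "compact (frontier E)" using \<open>compact E\<close> by (rule compact_frontier)
  then obtain z and s :: "nat \<Rightarrow> nat" where z: "z \<in> frontier E" and s: "strict_mono s" "(x \<circ> s) \<longlonglongrightarrow> z"
    using x(1) unfolding compact_def by metis
  define q where "q = r \<circ> s"
  have "strict_mono q" using r(1) s(1) by (simp add: q_def strict_mono_o)
  note sub = eventually_subseq[OF \<open>strict_mono q\<close>]
  define y where "y = x \<circ> s"
  have y: "y \<longlonglongrightarrow> z" "\<And>k. e < gs (q k) (y k)"
    using s(2) x(2) by (simp_all add: y_def q_def o_def)
  \<comment> \<open>With \<open>t = exp (- e)\<close> the barrier bound \<open>- ln t\<close> is
    \<open>e\<close>.\<close>
  have "0 < exp (- e)" "exp (- e) < 1" using \<open>e > 0\<close> by auto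
  then obtain \<kappa> where "\<kappa> > 0" and \<kappa>:
    "\<And>E g C a b \<zeta>. compact E \<Longrightarrow> green_at_infinity E g \<Longrightarrow> connected C \<Longrightarrow> C \<subseteq> E \<Longrightarrow> a \<in> C \<Longrightarrow> b \<in> C \<Longrightarrow>
       a \<noteq> b \<Longrightarrow> norm (\<zeta> - a) < \<kappa> * norm (\<zeta> - b) \<Longrightarrow> g \<zeta> \<le> - ln (exp (- e))"
    using green_barrier by blast
  have shrink: "\<exists>\<eta>>0. \<eta> \<le> d \<and> (\<forall>\<^sub>F k in sequentially. \<forall>C\<in>\<C> (q k). C \<inter> ball z \<eta> \<noteq> {} \<longrightarrow> C \<subseteq> ball z d)"
    if "d > 0" for d
  proof -
    \<comment> \<open>If a component had a point \<open>a\<close> within \<open>\<eta>\<close> of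
      \<open>z\<close> and a point \<open>b\<close> outside the ball of radius \<open>d\<close>,
      then \<open>\<bar>y k - a\<bar> < 2 * \<eta> \<le> \<kappa> * d / 2\<close> and
      \<open>\<bar>y k - b\<bar> \<ge> d - \<eta> \<ge> 3 * d / 4\<close>. The barrier would give
      the bound \<open>e\<close> at \<open>y k\<close>.\<close>
    define \<eta> where "\<eta> = min (d / 4) (\<kappa> * d / 4)"
    have \<eta>: "\<eta> > 0" "\<eta> \<le> d / 4" "\<eta> \<le> \<kappa> * d / 4"
      using \<open>d > 0\<close> \<open>\<kappa> > 0\<close> by (auto simp: \<eta>_def)
    have "\<forall>\<^sub>F k in sequentially. dist (y k) z < \<eta>"
      using y(1) \<eta>(1) by (rule tendstoD)
    with sub[OF ev] sub[OF comps]
    have "\<forall>\<^sub>F k in sequentially. \<forall>C\<in>\<C> (q k). C \<inter> ball z \<eta> \<noteq> {} \<longrightarrow> C \<subseteq> ball z d"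
    proof eventually_elim
      case (elim k)
      show ?case
      proof (intro ballI impI subsetI, rule ccontr)
        fix C b assume C: "C \<in> \<C> (q k)" "C \<inter> ball z \<eta> \<noteq> {}" and b: "b \<in> C" "b \<notin> ball z d"
        then obtain a where a: "a \<in> C" "a \<in> ball z \<eta>" by blast
        have "compact (Es (q k))" using elim(1) by blast
        then have "frontier (Es (q k)) \<subseteq> Es (q k)" by (intro frontier_subset_closed compact_imp_closed)
        then have "C \<subseteq> Es (q k)" using C(1) elim(2) by blast
        have "dist (y k) a < 2 * \<eta>"
          using a(2) elim(3) dist_triangle[of "y k" a z] by simp
        moreover have "3 * d / 4 \<le> dist (y k) b"
          using b(2) elim(3) dist_triangle[of z b "y k"] \<eta>(2) by (simp add: dist_commute)
        then have "\<kappa> * (3 * d / 4) \<le> \<kappa> * dist (y k) b"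
          using \<open>\<kappa> > 0\<close> by (intro mult_left_mono) auto
        moreover have "2 * \<eta> < \<kappa> * (3 * d / 4)"
        proof -
          have "0 < \<kappa> * d" using \<open>d > 0\<close> \<open>\<kappa> > 0\<close> by simp
          then show ?thesis using \<eta>(3) by simp
        qed
        ultimately have "norm (y k - a) < \<kappa> * norm (y k - b)" by (simp add: dist_norm)
        moreover have "a \<noteq> b" using a(2) b(2) \<eta>(2) \<open>d > 0\<close> by auto
        ultimately have "gs (q k) (y k) \<le> - ln (exp (- e))"
          using \<kappa>[of "Es (q k)" "gs (q k)" C a b "y k"] elim C(1) \<open>C \<subseteq> Es (q k)\<close> a(1) b(1) by blast
        then show False using y(2)[of k] by simp
      qed
    qed
    then show ?thesis using \<eta> \<open>d > 0\<close> by (intro exI[of _ \<eta>]) auto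
  qed
  \<comment> \<open>Boundary components reaching close to \<open>z\<close> are small, but \<open>z\<close> is not isolated in \<open>frontier E\<close>; so
    every ball around \<open>z\<close> eventually contains arbitrarily many of them.\<close>
  have many: "\<forall>d>0. \<forall>\<^sub>F k in sequentially. \<exists>T. finite T \<and> card T = m \<and> T \<subseteq> \<C> (q k) \<and> \<Union> T \<subseteq> ball z d" for m
  proof (induction m)
    case 0
    show ?case by (auto intro!: always_eventually exI[of _ "{}"])
  next
    case (Suc m)
    show ?case
    proof (intro allI impI)
      fix d :: real assume "d > 0"
      then obtain \<eta> where \<eta>: "\<eta> > 0" "\<eta> \<le> d"
        and near: "\<forall>\<^sub>F k in sequentially. \<forall>C\<in>\<C> (q k). C \<inter> ball z \<eta> \<noteq> {} \<longrightarrow> C \<subseteq> ball z d"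
        using shrink by blast
      \<comment> \<open>The induction hypothesis is used with half the distance from
        \<open>z\<close> to \<open>p\<close> as radius, hence the quantifier over \<open>d\<close>.
        The new component contains a point close to \<open>p\<close>, outside that smaller ball, and
        so differs from the \<open>m\<close> old ones.\<close>
      obtain p where p: "p \<in> frontier E" "p \<noteq> z" "dist p z < \<eta>"
        using frontier_not_isolated[OF \<open>compact E\<close> green conn z \<eta>(1)] by blast
      obtain \<zeta> where \<zeta>: "\<forall>\<^sub>F n in sequentially. \<zeta> n \<in> frontier (Es n)" "\<zeta> \<longlonglongrightarrow> p"
        using bdry[OF p(1)] by blast
      have "(\<lambda>k. \<zeta> (q k)) \<longlonglongrightarrow> p"
        using LIMSEQ_subseq_LIMSEQ[OF \<zeta>(2) \<open>strict_mono q\<close>] by (simp add: o_def)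
      then have lim: "(\<lambda>k. dist (\<zeta> (q k)) z) \<longlonglongrightarrow> dist p z" by (intro tendsto_dist tendsto_const)
      have 1: "\<forall>\<^sub>F k in sequentially. dist (\<zeta> (q k)) z < \<eta>"
        using order_tendstoD(2)[OF lim p(3)] .
      have 2: "\<forall>\<^sub>F k in sequentially. dist p z / 2 < dist (\<zeta> (q k)) z"
        using p(2) by (intro order_tendstoD(1)[OF lim]) simp
      have 3: "\<forall>\<^sub>F k in sequentially. \<exists>T. finite T \<and> card T = m \<and> T \<subseteq> \<C> (q k) \<and> \<Union> T \<subseteq> ball z (dist p z / 2)"
        using Suc p(2) by simp
      from 1 2 3 near sub[OF \<zeta>(1)] sub[OF comps]
      show "\<forall>\<^sub>F k in sequentially. \<exists>T. finite T \<and> card T = Suc m \<and> T \<subseteq> \<C> (q k) \<and> \<Union> T \<subseteq> ball z d"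
      proof eventually_elim
        case (elim k)
        obtain T where T: "finite T" "card T = m" "T \<subseteq> \<C> (q k)" "\<Union> T \<subseteq> ball z (dist p z / 2)"
          using elim(3) by blast
        obtain C where C: "C \<in> \<C> (q k)" "\<zeta> (q k) \<in> C" using elim(5,6) by blast
        have "\<zeta> (q k) \<in> ball z \<eta>" using elim(1) by (simp add: dist_commute)
        then have "C \<subseteq> ball z d" using elim(4) C by blast
        have "\<zeta> (q k) \<notin> ball z (dist p z / 2)" using elim(2) by (simp add: dist_commute)
        then have "C \<notin> T" using T(4) C(2) by blast
        have "dist p z / 2 \<le> d" using p(3) \<eta>(2) zero_le_dist[of p z] by linarith
        then have "ball z (dist p z / 2) \<subseteq> ball z d" by (rule subset_ball)
        then have "\<Union> (insert C T) \<subseteq> ball z d" using T(4) \<open>C \<subseteq> ball z d\<close> by blast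
        then show ?case
          using T C(1) \<open>C \<notin> T\<close> by (intro exI[of _ "insert C T"]) auto
      qed
    qed
  qed
  have "\<forall>\<^sub>F k in sequentially. \<exists>T. finite T \<and> card T = Suc N \<and> T \<subseteq> \<C> (q k) \<and> \<Union> T \<subseteq> ball z 1"
    using many[of "Suc N"] by simp
  then have "\<forall>\<^sub>F k in sequentially. False"
    using sub[OF comps]
  proof eventually_elim
    case (elim k)
    obtain T where T: "card T = Suc N" "T \<subseteq> \<C> (q k)" using elim(1) by blast
    have "card T \<le> card (\<C> (q k))" using elim(2) T(2) by (intro card_mono) auto
    moreover have "card (\<C> (q k)) \<le> N" using elim(2) by blast
    ultimately show False using T(1) by linarith
  qed
  then show False by simp
qed

text \<open>\<open>kernel\<close> is stated for closed rather than compact sets because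
  \<open>{g \<ge> e / 2}\<close> contains a neighbourhood of the pole at infinity; it is compact
  only on the sphere, with the pole added.\<close>

lemma green_uniform_limit:
  fixes Es :: "nat \<Rightarrow> complex set" and gs :: "nat \<Rightarrow> complex \<Rightarrow> real" and N :: nat
  assumes "compact E" and green: "green_at_infinity E g"
    and conn: "\<And>A. open A \<Longrightarrow> bounded A \<Longrightarrow> A \<subseteq> - E \<Longrightarrow> open (- E - A) \<Longrightarrow> A = {}"
    and ev: "\<forall>\<^sub>F n in sequentially. compact (Es n) \<and> green_at_infinity (Es n) (gs n)"
    and kernel: "\<And>K. closed K \<Longrightarrow> K \<subseteq> - E \<Longrightarrow> \<forall>\<^sub>F n in sequentially. K \<inter> Es n = {}"
    and bdry: "\<And>z. z \<in> frontier E \<Longrightarrow>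
       \<exists>\<zeta>. (\<forall>\<^sub>F n in sequentially. \<zeta> n \<in> frontier (Es n)) \<and> \<zeta> \<longlonglongrightarrow> z"
    and comps: "\<forall>\<^sub>F n in sequentially. finite (\<C> n) \<and> card (\<C> n) \<le> N \<and> \<Union> (\<C> n) = frontier (Es n)
       \<and> (\<forall>C\<in>\<C> n. connected C)"
  shows "uniform_limit UNIV gs g sequentially"
proof (rule uniform_limitI)
  fix e :: real assume "e > 0"
  then have "e / 2 > 0" by simp
  define K where "K = g -` {e / 2..}"
  have "closed E" using \<open>compact E\<close> by (rule compact_imp_closed)
  have "closed K"
    unfolding K_def using green_at_infinityD(1)[OF green] by (intro closed_vimage) auto
  moreover have "K \<subseteq> - E"
    using green_at_infinityD(3)[OF green] \<open>e > 0\<close> by (auto simp: K_def)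
  ultimately have 1: "\<forall>\<^sub>F n in sequentially. K \<inter> Es n = {}" by (rule kernel)
  have 2: "\<forall>\<^sub>F n in sequentially. \<forall>z\<in>frontier E. gs n z \<le> e / 2"
    by (rule green_small_on_frontier[OF \<open>compact E\<close> green conn ev bdry comps \<open>e / 2 > 0\<close>])
  from 1 2 ev show "\<forall>\<^sub>F n in sequentially. \<forall>z\<in>UNIV. dist (gs n z) (g z) < e"
  proof eventually_elim
    case (elim n)
    have En: "closed (Es n)" "green_at_infinity (Es n) (gs n)"
      using elim(3) by (auto intro: compact_imp_closed)
    show ?case
    proof
      fix z
      have "gs n x \<le> e / 2" if "x \<in> E" for x
        using green_le_on_of_frontier[OF En \<open>compact E\<close>, of "e / 2"] elim(2) that \<open>e > 0\<close> by simp
      then have "gs n z \<le> g z + e / 2"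
        using \<open>e > 0\<close> by (intro green_comparison[OF En \<open>closed E\<close> green]) auto
      moreover have "g x \<le> e / 2" if "x \<in> Es n" for x
        using elim(1) that by (force simp: K_def)
      then have "g z \<le> gs n z + e / 2"
        using \<open>e > 0\<close> by (intro green_comparison[OF \<open>closed E\<close> green En]) auto
      ultimately show "dist (gs n z) (g z) < e" using \<open>e > 0\<close> by (simp add: dist_real_def)
    qed
  qed
qed

section \<open>Charts of the sphere\<close>

text \<open>The plane parametrises the sphere without \<open>w\<close>, and \<open>w\<close> plays
  the role of its infinity. Sets are carried to the plane by taking preimages.\<close>

definition sphere_chart :: "complex option \<Rightarrow> complex \<Rightarrow> complex option" where
  "sphere_chart w z = (case w of None \<Rightarrow> Some z | Some a \<Rightarrow> if z = 0 then None else Some (a + 1 / z))"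

lemma inj_sphere_chart: "inj (sphere_chart w)"
  by (auto simp: inj_def sphere_chart_def split: option.splits if_splits)

lemma range_sphere_chart: "range (sphere_chart w) = - {w}"
proof (cases w)
  case None
  then show ?thesis by (auto simp: sphere_chart_def image_def)
next
  case (Some a)
  have "x \<in> range (sphere_chart (Some a))" if "x \<noteq> Some a" for x
  proof (cases x)
    case None
    then show ?thesis by (auto simp: sphere_chart_def image_def)
  next
    case (Some y)
    then have "x = sphere_chart (Some a) (1 / (y - a))" using that by (simp add: sphere_chart_def)
    then show ?thesis by blast
  qed
  then show ?thesis using Some by (auto simp: sphere_chart_def)
qed

lemma sphere_chart_neq: "sphere_chart w z \<noteq> w" "w \<noteq> sphere_chart w z"
  using range_sphere_chart[of w] by (metis ComplD rangeI singletonI)+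

lemma sphere_chart_surj: "x \<noteq> w \<Longrightarrow> \<exists>z. x = sphere_chart w z"
  using range_sphere_chart[of w] by blast

text \<open>\<open>V\<close> and \<open>W\<close> correspond under \<open>z \<mapsto> 1 / z\<close>
  away from \<open>0\<close>. The point \<open>0\<close> of one plane is infinity in the other,
  where a neighbourhood has bounded complement. The relation is symmetric, so the lemma serves both
  directions of a change of chart.\<close>

lemma open_inversion:
  fixes V W :: "complex set"
  assumes VW: "\<And>z. z \<noteq> 0 \<Longrightarrow> z \<in> W \<longleftrightarrow> 1 / z \<in> V" and "open V" and inf: "0 \<in> W \<Longrightarrow> bounded (- V)"
  shows "open W" "0 \<in> V \<Longrightarrow> bounded (- W)"
proof -
  show "open W"
    unfolding open_iff_eventually_nhds
  proof
    fix z assume "z \<in> W"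
    show "\<forall>\<^sub>F x in nhds z. x \<in> W"
    proof (cases "z = 0")
      case True
      then obtain B where "B > 0" "\<And>x. x \<in> - V \<Longrightarrow> norm x \<le> B"
        using inf \<open>z \<in> W\<close> by (auto simp: bounded_pos)
      have "x \<in> W" if "dist x z < 1 / B" for x
      proof (cases "x = 0")
        case False
        then have "B < norm (1 / x)"
          using that True \<open>B > 0\<close> by (simp add: norm_divide field_simps)
        then have "1 / x \<in> V" using \<open>\<And>x. x \<in> - V \<Longrightarrow> norm x \<le> B\<close>[of "1 / x"] by fastforce
        then show ?thesis using VW[OF False] by simp
      qed (use True \<open>z \<in> W\<close> in simp)
      then show ?thesis unfolding eventually_nhds_metric using \<open>B > 0\<close> by (intro exI[of _ "1 / B"]) auto
    next
      case False
      then have "((\<lambda>x. 1 / x) \<longlongrightarrow> 1 / z) (nhds z)" by (intro tendsto_intros filterlim_ident)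
      then have "\<forall>\<^sub>F x in nhds z. 1 / x \<in> V"
        using \<open>open V\<close> VW[OF False] \<open>z \<in> W\<close> by (intro topological_tendstoD) auto
      moreover have "\<forall>\<^sub>F x in nhds z. x \<noteq> 0"
        using False by (intro t1_space_nhds)
      ultimately show ?thesis by eventually_elim (rule VW[THEN iffD2])
    qed
  qed
  show "bounded (- W)" if "0 \<in> V"
  proof -
    obtain r where "r > 0" "ball 0 r \<subseteq> V"
      using open_contains_ball_eq[OF \<open>open V\<close>] \<open>0 \<in> V\<close> by metis
    have "norm x \<le> 1 / r" if "x \<in> - W" for x
    proof (rule ccontr)
      assume "\<not> norm x \<le> 1 / r"
      then have large: "1 / r < norm x" by simp
      then have "x \<noteq> 0" using \<open>r > 0\<close> by (auto simp: not_less)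
      have "norm (1 / x) < r" using large \<open>r > 0\<close> \<open>x \<noteq> 0\<close> by (simp add: norm_divide field_simps)
      then show False using \<open>ball 0 r \<subseteq> V\<close> VW[OF \<open>x \<noteq> 0\<close>] that by auto
    qed
    then show ?thesis unfolding bounded_iff by blast
  qed
qed

lemma openin_sphere_None:
  "openin riemann_sphere U \<longleftrightarrow> open (Some -` U) \<and> (None \<in> U \<longrightarrow> bounded (- (Some -` U)))"
proof
  assume "openin riemann_sphere U"
  then consider V where "open V" "U = Some ` V"
    | C where "compact C" "U = insert None (Some ` (- C))"
    by (auto simp: openin_Alexandroff_compactification Compl_eq_Diff_UNIV)
  then show "open (Some -` U) \<and> (None \<in> U \<longrightarrow> bounded (- (Some -` U)))"
  proof cases
    case 1
    then show ?thesis by (auto simp: inj_vimage_image_eq)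
  next
    case 2
    then have "Some -` U = - C" by auto
    then show ?thesis using 2 by (simp add: compact_imp_bounded compact_imp_closed open_Compl)
  qed
next
  assume R: "open (Some -` U) \<and> (None \<in> U \<longrightarrow> bounded (- (Some -` U)))"
  show "openin riemann_sphere U"
  proof (cases "None \<in> U")
    case False
    then have eq: "Some ` (Some -` U) = U" by (auto simp: image_iff) (metis not_Some_eq)
    have "openin riemann_sphere (Some ` (Some -` U))"
      using R by (simp only: openin_Alexandroff_compactification_image_Some open_openin)
    then show ?thesis by (simp only: eq)
  next
    case True
    then have "compact (- (Some -` U))"
      using R by (simp add: compact_eq_bounded_closed closed_Compl)
    moreover have "U = insert None (Some ` (UNIV - (- (Some -` U))))"
      using True by (auto simp: image_iff)
    ultimately show ?thesis
      unfolding openin_Alexandroff_compactification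
      by (intro disjI2 exI[of _ "- (Some -` U)"]) (auto simp: compact_imp_closed)
  qed
qed

lemma bounded_iff_translation: "bounded ((\<lambda>y. a + y) ` S) \<longleftrightarrow> bounded (S :: 'a::real_normed_vector set)"
proof
  assume "bounded ((\<lambda>y. a + y) ` S)"
  from bounded_translation[OF this, of "- a"] show "bounded S" by (simp add: image_image)
qed (rule bounded_translation)

text \<open>Open sets have the same description in every chart: for finite \<open>w\<close> a
  translation and an inversion lead back to the identity chart. Questions about the topology of the
  sphere can thus be settled in the plane.\<close>

lemma openin_sphere_chart:
  "openin riemann_sphere U \<longleftrightarrow>
     open (sphere_chart w -` U) \<and> (w \<in> U \<longrightarrow> bounded (- (sphere_chart w -` U)))"
proof (cases w)
  case None
  have "sphere_chart None = Some" by (auto simp: sphere_chart_def)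
  then show ?thesis using None openin_sphere_None by simp
next
  case (Some a)
  define V where "V = (\<lambda>y. a + y) -` (Some -` U)"
  define W where "W = sphere_chart (Some a) -` U"
  have *: "z \<in> W \<longleftrightarrow> 1 / z \<in> V" if "z \<noteq> 0" for z
    using that by (simp add: W_def V_def sphere_chart_def)
  then have **: "z \<in> V \<longleftrightarrow> 1 / z \<in> W" if "z \<noteq> 0" for z
    using that by simp
  have 0: "0 \<in> W \<longleftrightarrow> None \<in> U" "0 \<in> V \<longleftrightarrow> Some a \<in> U" by (auto simp: W_def V_def sphere_chart_def)
  have eq: "Some -` U = (\<lambda>y. a + y) ` V"
  proof -
    have "surj (\<lambda>y. a + y)" by (rule surj_plus)
    then show ?thesis unfolding V_def by (simp add: surj_image_vimage_eq)
  qed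
  have 1: "open (Some -` U) \<longleftrightarrow> open V"
    unfolding eq using open_translation[of V a] open_translation[of "(\<lambda>y. a + y) ` V" "- a"]
    by (auto simp: image_image)
  have "- (Some -` U) = (\<lambda>y. a + y) ` (- V)"
    unfolding eq by (rule bij_image_Compl_eq[symmetric]) (simp add: bij_plus)
  then have 2: "bounded (- (Some -` U)) \<longleftrightarrow> bounded (- V)"
    by (simp add: bounded_iff_translation)
  have "openin riemann_sphere U \<longleftrightarrow> open V \<and> (0 \<in> W \<longrightarrow> bounded (- V))"
    unfolding openin_sphere_None 0 1 2 ..
  also have "\<dots> \<longleftrightarrow> open W \<and> (0 \<in> V \<longrightarrow> bounded (- W))"
  proof
    assume "open V \<and> (0 \<in> W \<longrightarrow> bounded (- V))"
    then show "open W \<and> (0 \<in> V \<longrightarrow> bounded (- W))"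
      using open_inversion[OF *] by simp
  next
    assume "open W \<and> (0 \<in> V \<longrightarrow> bounded (- W))"
    then show "open V \<and> (0 \<in> W \<longrightarrow> bounded (- V))"
      using open_inversion[OF **] by simp
  qed
  finally show ?thesis unfolding Some W_def 0 .
qed

lemma topspace_sphere: "topspace riemann_sphere = UNIV"
  by (auto simp: image_iff)

lemma openin_sphere_chart_image: "openin riemann_sphere (sphere_chart w ` A) \<longleftrightarrow> open A"
proof -
  have "w \<notin> sphere_chart w ` A" using sphere_chart_neq by blast
  then show ?thesis
    by (simp add: openin_sphere_chart[of _ w] inj_vimage_image_eq inj_sphere_chart)
qed

lemma compact_complement_chart:
  assumes "openin riemann_sphere \<Omega>" "w \<in> \<Omega>"
  shows "compact (- (sphere_chart w -` \<Omega>))"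
  using assms openin_sphere_chart[of \<Omega> w] by (simp add: compact_eq_bounded_closed closed_Compl)

lemma frontier_of_open_disjoint:
  assumes "openin X \<Omega>" "x \<in> \<Omega>"
  shows "x \<notin> X frontier_of \<Omega>"
  using assms by (simp add: frontier_of_def interior_of_openin)

lemma frontier_of_sphere_chart:
  assumes "openin riemann_sphere \<Omega>"
  shows "sphere_chart w z \<in> riemann_sphere frontier_of \<Omega> \<longleftrightarrow> z \<in> frontier (sphere_chart w -` \<Omega>)"
proof -
  have "open (sphere_chart w -` \<Omega>)" using assms openin_sphere_chart by blast
  have "sphere_chart w z \<in> riemann_sphere closure_of \<Omega> \<longleftrightarrow> z \<in> closure (sphere_chart w -` \<Omega>)"
  proof
    assume L: "sphere_chart w z \<in> riemann_sphere closure_of \<Omega>"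
    show "z \<in> closure (sphere_chart w -` \<Omega>)"
      unfolding closure_iff_nhds_not_empty
    proof (intro allI impI)
      fix A S assume S: "S \<subseteq> A" "open S" "z \<in> S"
      then have "\<exists>y. y \<in> \<Omega> \<and> y \<in> sphere_chart w ` S"
        using L unfolding in_closure_of by (meson imageI openin_sphere_chart_image)
      then show "sphere_chart w -` \<Omega> \<inter> A \<noteq> {}" using S(1) by blast
    qed
  next
    assume R: "z \<in> closure (sphere_chart w -` \<Omega>)"
    show "sphere_chart w z \<in> riemann_sphere closure_of \<Omega>"
      unfolding in_closure_of topspace_sphere
    proof (intro conjI UNIV_I allI impI)
      fix T assume T: "sphere_chart w z \<in> T \<and> openin riemann_sphere T"
      then have "open (sphere_chart w -` T)" using openin_sphere_chart by blast
      then have "sphere_chart w -` \<Omega> \<inter> sphere_chart w -` T \<noteq> {}"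
        using R T unfolding closure_iff_nhds_not_empty by blast
      then show "\<exists>y. y \<in> \<Omega> \<and> y \<in> T" by blast
    qed
  qed
  then show ?thesis
    using assms \<open>open (sphere_chart w -` \<Omega>)\<close>
    by (simp add: frontier_of_def frontier_def interior_of_openin interior_open)
qed

lemma connected_vimage_sphere_chart:
  assumes "connectedin riemann_sphere K" "w \<notin> K"
  shows "connected (sphere_chart w -` K)"
  unfolding connected_def
proof (rule notI, elim exE conjE)
  fix A B assume AB: "open A" "open B" "sphere_chart w -` K \<subseteq> A \<union> B"
    "A \<inter> B \<inter> sphere_chart w -` K = {}" "A \<inter> sphere_chart w -` K \<noteq> {}" "B \<inter> sphere_chart w -` K \<noteq> {}"
  let ?c = "sphere_chart w"
  have "openin riemann_sphere (?c ` A)" "openin riemann_sphere (?c ` B)"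
    using AB(1,2) by (simp_all only: openin_sphere_chart_image)
  moreover have "K \<subseteq> ?c ` A \<union> ?c ` B"
  proof
    fix x assume "x \<in> K"
    then have "x \<noteq> w" using assms(2) by auto
    then obtain z where "x = ?c z" using sphere_chart_surj by blast
    then show "x \<in> ?c ` A \<union> ?c ` B" using AB(3) \<open>x \<in> K\<close> by blast
  qed
  moreover have "?c ` A \<inter> ?c ` B \<inter> K = {}"
    using AB(4) inj_sphere_chart[of w] by (auto simp: inj_eq)
  moreover have "?c ` A \<inter> K \<noteq> {}" "?c ` B \<inter> K \<noteq> {}" using AB(5,6) by blast+
  ultimately show False using assms(1) unfolding connectedin by blast
qed

section \<open>Transport of the hypotheses into the chart\<close>

lemma chart_complement_no_bounded_component:
  assumes \<Omega>: "openin riemann_sphere \<Omega>" "connectedin riemann_sphere \<Omega>" "w \<in> \<Omega>"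
    and A: "open A" "bounded A" "A \<subseteq> sphere_chart w -` \<Omega>" "open (sphere_chart w -` \<Omega> - A)"
  shows "A = {}"
proof (rule ccontr)
  let ?c = "sphere_chart w"
  assume "A \<noteq> {}"
  have eq: "?c -` (\<Omega> - ?c ` A) = ?c -` \<Omega> - A"
    using inj_image_mem_iff[OF inj_sphere_chart[of w]] by blast
  \<comment> \<open>Since \<open>A\<close> is bounded, removing it leaves a neighbourhood of
    infinity. So \<open>\<Omega>\<close> without the image of \<open>A\<close> is open at
    \<open>w\<close> too, and a nonempty \<open>A\<close> would disconnect
    \<open>\<Omega>\<close>.\<close>
  have "bounded (- (?c -` \<Omega> - A))"
    using compact_imp_bounded[OF compact_complement_chart[OF \<Omega>(1,3)]] A(2) by (simp add: Compl_Diff_eq)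
  then have "openin riemann_sphere (\<Omega> - ?c ` A)"
    using A(4) openin_sphere_chart[of "\<Omega> - ?c ` A" w] by (simp only: eq simp_thms)
  moreover have "openin riemann_sphere (?c ` A)" using A(1) by (simp only: openin_sphere_chart_image)
  moreover have "?c ` A \<subseteq> \<Omega>" using A(3) by blast
  moreover have "w \<in> \<Omega> - ?c ` A" using \<Omega>(3) sphere_chart_neq by blast
  moreover have "\<not> (openin riemann_sphere E1 \<and> openin riemann_sphere E2 \<and> \<Omega> \<subseteq> E1 \<union> E2 \<and>
      E1 \<inter> E2 \<inter> \<Omega> = {} \<and> E1 \<inter> \<Omega> \<noteq> {} \<and> E2 \<inter> \<Omega> \<noteq> {})" for E1 E2
    using \<Omega>(2) unfolding connectedin by metis
  from this[of "?c ` A" "\<Omega> - ?c ` A"] have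
    "openin riemann_sphere (?c ` A) \<Longrightarrow> openin riemann_sphere (\<Omega> - ?c ` A) \<Longrightarrow>
      ?c ` A \<inter> \<Omega> = {} \<or> (\<Omega> - ?c ` A) \<inter> \<Omega> = {}" by blast
  ultimately show False using \<open>A \<noteq> {}\<close> by blast
qed

lemma greens_function_imp_green_at_infinity:
  assumes \<Omega>: "openin riemann_sphere \<Omega>" "w \<in> \<Omega>" and g: "greens_function \<Omega> w g"
  shows "green_at_infinity (- (sphere_chart w -` \<Omega>)) (g \<circ> sphere_chart w)"
proof -
  let ?c = "sphere_chart w"
  have "continuous_map euclidean (subtopology riemann_sphere (- {w})) ?c"
  proof (rule continuous_map_into_subtopology)
    have "openin euclidean {x \<in> topspace euclidean. ?c x \<in> U}" if "openin riemann_sphere U" for U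
      using that openin_sphere_chart[of U w] by (simp add: vimage_def)
    then show "continuous_map euclidean riemann_sphere ?c"
      unfolding continuous_map_def topspace_sphere by blast
    show "?c \<in> topspace euclidean \<rightarrow> - {w}" using sphere_chart_neq by auto
  qed
  moreover have "continuous_map (subtopology riemann_sphere (- {w})) euclideanreal g"
    using g by (simp add: greens_function_def)
  ultimately have "continuous_map euclidean euclideanreal (g \<circ> ?c)"
    by (rule continuous_map_compose)
  then have cont: "continuous_on UNIV (g \<circ> ?c)" by simp
  have zero: "(g \<circ> ?c) z = 0" if "z \<in> - (?c -` \<Omega>)" for z
    using g that by (simp add: greens_function_def)
  have hplane: "harmonic_on_plane (Some -` (\<Omega> - {w})) (g \<circ> Some)"
    and hinf: "harmonic_on_plane (chart_infinity -` (\<Omega> - {w})) (g \<circ> chart_infinity)"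
    using g by (auto simp: greens_function_def harmonic_on_sphere_def)
  have harm: "harm_at (g \<circ> ?c) z" if z: "?c z \<in> \<Omega>" for z
  proof (cases w)
    case None
    then have "?c = Some" by (auto simp: sphere_chart_def)
    then show ?thesis
      using harmonic_on_plane_imp_harm_at[OF hplane, of z] z None by simp
  next
    case (Some a)
    show ?thesis
    proof (cases "z = 0")
      case False
      have "harm_at (g \<circ> Some) (a + 1 / z)"
        by (rule harmonic_on_plane_imp_harm_at[OF hplane])
           (use z Some False in \<open>auto simp: sphere_chart_def\<close>)
      then have "harm_at (\<lambda>x. (g \<circ> Some) (a + 1 / x)) z"
        by (rule harm_at_compose) (use False in \<open>auto intro!: analytic_intros\<close>)
      moreover have "\<forall>\<^sub>F x in nhds z. x \<noteq> 0" using False by (intro t1_space_nhds)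
      then have "\<forall>\<^sub>F x in nhds z. (g \<circ> Some) (a + 1 / x) = (g \<circ> ?c) x"
        by eventually_elim (simp add: Some sphere_chart_def)
      ultimately show ?thesis by (rule harm_at_cong)
    next
      case True
      \<comment> \<open>The transition map to the chart at infinity: \<open>a + 1 / x\<close> is the
        reciprocal of \<open>h x\<close>, and \<open>h\<close> is analytic near \<open>0\<close> and
        fixes \<open>0\<close>.\<close>
      define h where "h x = x / (1 + a * x)" for x
      have "h z = 0" by (simp add: h_def True)
      have "None \<in> \<Omega>" using z True Some by (simp add: sphere_chart_def)
      then have "harm_at (g \<circ> chart_infinity) (h z)"
        using Some by (intro harmonic_on_plane_imp_harm_at[OF hinf]) (simp add: chart_infinity_def \<open>h z = 0\<close>)
      moreover have "h analytic_on {z}"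
        unfolding h_def using True by (intro analytic_intros) auto
      ultimately have "harm_at (\<lambda>x. (g \<circ> chart_infinity) (h x)) z" by (rule harm_at_compose)
      moreover have "\<forall>\<^sub>F x in nhds z. 1 + a * x \<noteq> 0"
      proof -
        have "((\<lambda>x. 1 + a * x) \<longlongrightarrow> 1 + a * z) (nhds z)" by (intro tendsto_intros filterlim_ident)
        then show ?thesis using True by (intro tendsto_imp_eventually_ne) auto
      qed
      then have "\<forall>\<^sub>F x in nhds z. (g \<circ> chart_infinity) (h x) = (g \<circ> ?c) x"
      proof eventually_elim
        case (elim x)
        then have "chart_infinity (h x) = ?c x"
          by (auto simp: chart_infinity_def h_def Some sphere_chart_def field_simps)
        then show ?case by simp
      qed
      ultimately show ?thesis by (rule harm_at_cong)
    qed
  qed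
  have "\<exists>M. \<forall>\<^sub>F z in at_infinity. \<bar>(g \<circ> ?c) z - ln (norm z)\<bar> \<le> M"
  proof (cases w)
    case None
    then have "(\<lambda>z. g (Some z) - ln (cmod z)) \<in> O[at_infinity](\<lambda>_. 1)"
      using g by (simp add: greens_function_def)
    then show ?thesis using None by (auto elim!: landau_o.bigE simp: sphere_chart_def)
  next
    case (Some a)
    then have "(\<lambda>z. g (Some z) - (- ln (cmod (z - a)))) \<in> O[at a](\<lambda>_. 1)"
      using g by (simp add: greens_function_def)
    then obtain M where M: "\<forall>\<^sub>F z in at a. \<bar>g (Some z) + ln (cmod (z - a))\<bar> \<le> M"
      by (auto elim!: landau_o.bigE)
    have "\<forall>\<^sub>F z in at_infinity. 0 < norm (z::complex)"
      using filterlim_at_top_dense[THEN iffD1, OF filterlim_norm_at_top] by blast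
    then have nz: "\<forall>\<^sub>F z in at_infinity. (z::complex) \<noteq> 0" by (simp only: zero_less_norm_iff)
    have "((\<lambda>z. 1 / z) \<longlongrightarrow> 0) (at_infinity :: complex filter)"
      by (intro tendsto_divide_0[OF tendsto_const] filterlim_ident)
    from tendsto_add[OF tendsto_const[of a] this]
    have "((\<lambda>z. a + 1 / z) \<longlongrightarrow> a) at_infinity" by simp
    then have "filterlim (\<lambda>z. a + 1 / z) (at a) at_infinity"
      using nz by (auto simp: filterlim_at elim: eventually_mono)
    then have "\<forall>\<^sub>F z in at_infinity. \<bar>g (Some (a + 1 / z)) + ln (cmod (a + 1 / z - a))\<bar> \<le> M"
      by (rule eventually_compose_filterlim[OF M])
    then have "\<forall>\<^sub>F z in at_infinity. \<bar>(g \<circ> ?c) z - ln (norm z)\<bar> \<le> M"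
      using nz by eventually_elim (simp add: Some sphere_chart_def norm_divide ln_div)
    then show ?thesis by blast
  qed
  then show ?thesis
    using cont zero harm by (auto simp: green_at_infinity_def)
qed

lemma kernel_eventually_superset_chart:
  assumes cover: "\<And>z. z \<in> \<Omega> \<Longrightarrow> \<exists>U. openin riemann_sphere U \<and> z \<in> U \<and> (\<forall>\<^sub>F n in sequentially. U \<subseteq> \<Omega>s n)"
    and "w \<in> \<Omega>" and K: "closed K" "K \<subseteq> sphere_chart w -` \<Omega>"
  shows "\<forall>\<^sub>F n in sequentially. K \<subseteq> sphere_chart w -` \<Omega>s n"
proof -
  let ?c = "sphere_chart w"
  \<comment> \<open>\<open>K\<close> may be unbounded. Adding \<open>w\<close> makes its image
    closed in the compact sphere, so finitely many of the open sets in \<open>cover\<close>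
    suffice.\<close>
  define S where "S = insert w (?c ` K)"
  have "?c -` (- S) = - K"
    using inj_image_mem_iff[OF inj_sphere_chart[of w]] sphere_chart_neq(1)[of w]
    unfolding S_def by blast
  then have "openin riemann_sphere (- S)"
    unfolding openin_sphere_chart[of _ w] using K(1) by (simp add: S_def open_Compl)
  then have "closedin riemann_sphere S"
    by (simp only: closedin_def topspace_sphere Compl_eq_Diff_UNIV subset_UNIV simp_thms)
  then have "compactin riemann_sphere S"
    using closedin_compact_space compact_space_Alexandroff_compactification by blast
  moreover define \<U> where "\<U> = {U. openin riemann_sphere U \<and> (\<forall>\<^sub>F n in sequentially. U \<subseteq> \<Omega>s n)}"
  have "S \<subseteq> \<Union> \<U>"
  proof
    fix x assume "x \<in> S"
    then have "x \<in> \<Omega>" using K(2) \<open>w \<in> \<Omega>\<close> by (auto simp: S_def)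
    from cover[OF this] show "x \<in> \<Union> \<U>" by (auto simp: \<U>_def)
  qed
  moreover have "\<forall>U\<in>\<U>. openin riemann_sphere U" by (simp add: \<U>_def)
  ultimately obtain \<F> where \<F>: "finite \<F>" "\<F> \<subseteq> \<U>" "S \<subseteq> \<Union> \<F>"
    unfolding compactin_def by meson
  have "\<forall>\<^sub>F n in sequentially. \<forall>U\<in>\<F>. U \<subseteq> \<Omega>s n"
    using \<F>(1,2) by (intro eventually_ball_finite) (auto simp: \<U>_def)
  then show ?thesis
  proof eventually_elim
    case (elim n)
    have "?c x \<in> \<Omega>s n" if "x \<in> K" for x
    proof -
      have "?c x \<in> S" using that by (simp add: S_def)
      then show ?thesis using \<F>(3) elim by blast
    qed
    then show ?case by blast
  qed
qed

theorem theorem4p1: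
  fixes \<Omega>s :: "nat \<Rightarrow> complex option set" and \<Omega> :: "complex option set" and N :: nat
  assumes "\<And>n. regular_domain (\<Omega>s n)"
    and "regular_domain \<Omega>"
    and "\<exists>w0. kernel_converges w0 \<Omega>s \<Omega>"
    and "\<And>n. finite (boundary_components (\<Omega>s n)) \<and> card (boundary_components (\<Omega>s n)) \<le> N"
  shows "\<forall>w\<in>\<Omega>. \<forall>gs g.
           (\<forall>n. w \<in> \<Omega>s n \<longrightarrow> greens_function (\<Omega>s n) w (gs n)) \<longrightarrow>
           greens_function \<Omega> w g \<longrightarrow>
           uniform_limit (range Some - {w}) gs g sequentially"
proof (intro ballI allI impI)
  fix w gs g
  assume w: "w \<in> \<Omega>" and gs: "\<forall>n. w \<in> \<Omega>s n \<longrightarrow> greens_function (\<Omega>s n) w (gs n)"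
    and g: "greens_function \<Omega> w g"
  let ?c = "sphere_chart w"
  obtain w0 where kernel: "kernel_converges w0 \<Omega>s \<Omega>" using assms(3) by blast
  have \<Omega>s: "openin riemann_sphere (\<Omega>s n)" for n
    using assms(1)[of n] by (simp add: regular_domain_def sphere_domain_def)
  have \<Omega>: "openin riemann_sphere \<Omega>" "connectedin riemann_sphere \<Omega>"
    using assms(2) by (simp_all add: regular_domain_def sphere_domain_def)
  have cover: "\<exists>U. openin riemann_sphere U \<and> z \<in> U \<and> (\<forall>\<^sub>F n in sequentially. U \<subseteq> \<Omega>s n)" if "z \<in> \<Omega>" for z
    using kernel that by (simp add: kernel_converges_def)
  \<comment> \<open>Nothing is known of \<open>gs n\<close> while \<open>w\<close> lies outside
    \<open>\<Omega>s n\<close>; hence the facts about the sequence hold only eventually.\<close>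
  have w_ev: "\<forall>\<^sub>F n in sequentially. w \<in> \<Omega>s n"
    using cover[OF w] by (auto elim: eventually_mono)
  define E where "E = - (?c -` \<Omega>)"
  define Es where "Es n = - (?c -` \<Omega>s n)" for n
  \<comment> \<open>Once \<open>w \<in> \<Omega>s n\<close>, the boundary components avoid
    \<open>w\<close>, so their preimages remain connected and cover the frontier of
    \<open>Es n\<close>.\<close>
  define \<C> where "\<C> n = (\<lambda>K. ?c -` K) ` boundary_components (\<Omega>s n)" for n
  have "uniform_limit UNIV (\<lambda>n. gs n \<circ> ?c) (g \<circ> ?c) sequentially"
  proof (rule green_uniform_limit[of E "g \<circ> ?c" Es "\<lambda>n. gs n \<circ> ?c" \<C> N])
    show "compact E" unfolding E_def by (rule compact_complement_chart[OF \<Omega>(1) w])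
    show "green_at_infinity E (g \<circ> ?c)"
      unfolding E_def by (rule greens_function_imp_green_at_infinity[OF \<Omega>(1) w g])
    show "A = {}" if "open A" "bounded A" "A \<subseteq> - E" "open (- E - A)" for A
      using chart_complement_no_bounded_component[OF \<Omega> w, of A] that by (simp add: E_def)
    show "\<forall>\<^sub>F n in sequentially. compact (Es n) \<and> green_at_infinity (Es n) (gs n \<circ> ?c)"
      using w_ev
      by eventually_elim
         (use \<Omega>s gs compact_complement_chart greens_function_imp_green_at_infinity in \<open>simp add: Es_def\<close>)
    show "\<forall>\<^sub>F n in sequentially. K \<inter> Es n = {}" if "closed K" "K \<subseteq> - E" for K
    proof -
      have "\<forall>\<^sub>F n in sequentially. K \<subseteq> ?c -` \<Omega>s n"
        by (rule kernel_eventually_superset_chart[OF cover w \<open>closed K\<close>]) (use that(2) in \<open>auto simp: E_def\<close>)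
      then show ?thesis by eventually_elim (auto simp: Es_def)
    qed
    show "\<exists>\<zeta>. (\<forall>\<^sub>F n in sequentially. \<zeta> n \<in> frontier (Es n)) \<and> \<zeta> \<longlonglongrightarrow> z" if z: "z \<in> frontier E" for z
    proof -
      have "?c z \<in> riemann_sphere frontier_of \<Omega>"
        using z by (simp add: E_def frontier_complement frontier_of_sphere_chart[OF \<Omega>(1)])
      then obtain \<zeta> where \<zeta>: "\<And>n. \<zeta> n \<in> riemann_sphere frontier_of (\<Omega>s n)"
        "limitin riemann_sphere \<zeta> (?c z) sequentially"
        using kernel unfolding kernel_converges_def by blast
      \<comment> \<open>The inverse is meaningful only if \<open>\<zeta> n \<noteq> w\<close>, which
        holds as soon as \<open>w\<close> is in the open set \<open>\<Omega>s n\<close>.\<close>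
      define \<xi> where "\<xi> n = inv ?c (\<zeta> n)" for n
      have chart: "\<forall>\<^sub>F n in sequentially. ?c (\<xi> n) = \<zeta> n"
        using w_ev
      proof eventually_elim
        case (elim n)
        have "\<zeta> n \<noteq> w" using frontier_of_open_disjoint[OF \<Omega>s elim] \<zeta>(1)[of n] by auto
        then have "\<zeta> n \<in> range ?c" by (simp add: range_sphere_chart)
        then show ?case unfolding \<xi>_def by (rule f_inv_into_f)
      qed
      have "\<forall>\<^sub>F n in sequentially. \<xi> n \<in> frontier (Es n)"
        using chart
      proof eventually_elim
        case (elim n)
        then show ?case
          using \<zeta>(1)[of n] frontier_of_sphere_chart[OF \<Omega>s[of n], of w "\<xi> n"]
          by (simp add: Es_def frontier_complement)
      qed
      moreover have "\<xi> \<longlonglongrightarrow> z"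
      proof (rule topological_tendstoI)
        fix T assume "open T" "z \<in> T"
        then have "openin riemann_sphere (?c ` T)" "?c z \<in> ?c ` T"
          by (simp_all only: openin_sphere_chart_image imageI)
        then have "\<forall>\<^sub>F n in sequentially. \<zeta> n \<in> ?c ` T"
          using \<zeta>(2) unfolding limitin_def by blast
        with chart show "\<forall>\<^sub>F n in sequentially. \<xi> n \<in> T"
          by eventually_elim (metis inj_image_mem_iff inj_sphere_chart)
      qed
      ultimately show ?thesis by blast
    qed
    show "\<forall>\<^sub>F n in sequentially. finite (\<C> n) \<and> card (\<C> n) \<le> N \<and> \<Union> (\<C> n) = frontier (Es n)
        \<and> (\<forall>C\<in>\<C> n. connected C)"
      using w_ev
    proof eventually_elim
      case (elim n)
      let ?F = "riemann_sphere frontier_of (\<Omega>s n)"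
      have fin: "finite (boundary_components (\<Omega>s n))" "card (boundary_components (\<Omega>s n)) \<le> N"
        using assms(4)[of n] by auto
      have "topspace (subtopology riemann_sphere ?F) = ?F"
        by (simp only: topspace_subtopology topspace_sphere Int_UNIV_left)
      then have Un: "\<Union> (boundary_components (\<Omega>s n)) = ?F"
        unfolding boundary_components_def by (simp only: Union_connected_components_of)
      have "\<Union> (\<C> n) = ?c -` \<Union> (boundary_components (\<Omega>s n))" by (auto simp: \<C>_def)
      also have "\<dots> = frontier (?c -` \<Omega>s n)"
        unfolding Un using frontier_of_sphere_chart[OF \<Omega>s[of n], of w] by auto
      finally have "\<Union> (\<C> n) = frontier (Es n)" by (simp add: Es_def frontier_complement)
      moreover have "connected C" if C: "C \<in> \<C> n" for C
      proof -
        obtain K where K: "K \<in> boundary_components (\<Omega>s n)" "C = ?c -` K" using C by (auto simp: \<C>_def)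
        have "connectedin (subtopology riemann_sphere ?F) K"
          using K(1) connectedin_connected_components_of unfolding boundary_components_def by blast
        then have "connectedin riemann_sphere K" "K \<subseteq> ?F" by (auto simp: connectedin_subtopology)
        moreover have "w \<notin> ?F" by (rule frontier_of_open_disjoint[OF \<Omega>s elim])
        ultimately show ?thesis using K(2) connected_vimage_sphere_chart by blast
      qed
      moreover have "card (\<C> n) \<le> N"
        using card_image_le[OF fin(1), of "\<lambda>K. ?c -` K"] fin(2) by (simp add: \<C>_def)
      ultimately show ?case using fin(1) by (simp add: \<C>_def)
    qed
  qed
  then have lim: "\<forall>\<^sub>F n in sequentially. \<forall>z. dist (gs n (?c z)) (g (?c z)) < e" if "e > 0" for e
    using that by (auto simp: uniform_limit_iff)
  show "uniform_limit (range Some - {w}) gs g sequentially"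
  proof (rule uniform_limitI)
    fix e :: real assume "e > 0"
    from lim[OF this] show "\<forall>\<^sub>F n in sequentially. \<forall>x\<in>range Some - {w}. dist (gs n x) (g x) < e"
    proof eventually_elim
      case (elim n)
      show ?case
      proof
        fix x assume "x \<in> range Some - {w}"
        then obtain z where "x = ?c z" using sphere_chart_surj by blast
        then show "dist (gs n x) (g x) < e" using elim by blast
      qed
    qed
  qed
qed

end
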